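(* Let $s\in(0,1)$ and let $\alpha\in(0,s]$. Then, for any sufficiently small $\epsilon>0$, there exists a function $v:(-1,0)\times\mathbb{R}^n\to\mathbb{R}$ satisfying: (i) $\partial_tv+(-\Delta)^sv=0$ in $(-1,0)\times B_1$; (ii) $v\in C^{\frac{\alpha}{2s}-\epsilon,\,\alpha}_{t,x}((-1,0)\times\mathbb{R}^n)$; (iii) $v\notin C^{1+\frac{\alpha}{2s}}_t\left(\left(-\frac12,0\right)\times B_{1/2}\right)$.
   Context: $B_r\subset\mathbb{R}^n$ is the ball of radius $r$ centred at the origin. The fractional Laplacian is given by $-(-\Delta)^sw(x)=c_{n,s}\int_{\mathbb{R}^n}\bigl(w(x+y)+w(x-y)-2w(x)\bigr)\frac{dy}{|y|^{n+2s}}$ with the usual positive normalization constant $c_{n,s}$ (Fourier symbol of $(-\Delta)^s$ equal to $|\xi|^{2s}$). The equation in (i) is understood in the weak sense: $\int_{(-1,0)\times\mathbb{R}^n}v(-\partial_t\eta+(-\Delta)^s\eta)\,dx\,dt=0$ for all $\eta\in C_c^\infty((-1,0)\times B_1)$. For $\alpha,\beta\in(0,1)$, $u\in C^{\beta,\alpha}_{t,x}(I\times D)$ means $\|u\|_{L^\infty(I\times D)}+\sup\frac{|u(t,x)-u(t',x')|}{|t-t'|^\beta+|x-x'|^\alpha}<\infty$ (supremum over distinct points of $I\times D$). For $\gamma>0$, $u\in C^\gamma_t(I\times D)$ means $\sup_{x\in D}\|u(\cdot,x)\|_{C^\gamma(I)}<\infty$, with $C^\gamma=C^{\lfloor\gamma\rfloor,\gamma-\lfloor\gamma\rfloor}$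 the usual Hölder space. *)

theory Defs
  imports "HOL-Analysis.Analysis"
begin

section \<open>The fractional Laplacian\<close>

text \<open>
  Applying the second-difference integral below to \<open>w(x) = cos (\<xi> \<bullet> x)\<close> multiplies it by
  \<open>- \<integral> (2 - 2 cos (\<xi> \<bullet> y)) / |y|\<^sup>n\<^sup>+\<^sup>2\<^sup>s dy\<close>. For \<open>0 < s < 1\<close> this integral is finite, positive,
  invariant under rotations of \<open>\<xi>\<close> and homogeneous of degree \<open>2s\<close> in \<open>\<xi>\<close>, so the symbol of the
  operator is \<open>|\<xi>|\<^sup>2\<^sup>s\<close> precisely when it is normalised at one (equivalently, any) unit vector \<open>\<xi>\<close>.
  The constant is half of the one appearing in the principal-value form of the operator.
\<close>

definition frac_lap_const :: "'a::euclidean_space itself \<Rightarrow> real \<Rightarrow> real" where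
  "frac_lap_const _ s =
     1 / (\<integral>y. (2 - 2 * cos ((SOME e::'a. norm e = 1) \<bullet> y))
              / norm y powr (real DIM('a) + 2 * s) \<partial>lborel)"

definition frac_lap :: "real \<Rightarrow> ('a::euclidean_space \<Rightarrow> real) \<Rightarrow> 'a \<Rightarrow> real" where
  "frac_lap s w x =
     - (frac_lap_const TYPE('a) s *
        (\<integral>y. (w (x + y) + w (x - y) - 2 * w x)
              / norm y powr (real DIM('a) + 2 * s) \<partial>lborel))"

section \<open>Test functions and weak solutions\<close>

text \<open>\<open>Ck k f\<close>: all iterated directional derivatives of \<open>f\<close> up to order \<open>k\<close> exist and are
  continuous on the whole space.\<close>

primrec Ck :: "nat \<Rightarrow> ('a::euclidean_space \<Rightarrow> real) \<Rightarrow> bool" where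
  "Ck 0 f \<longleftrightarrow> continuous_on UNIV f"
| "Ck (Suc k) f \<longleftrightarrow>
     (\<forall>x. f differentiable (at x)) \<and> (\<forall>h. Ck k (\<lambda>x. frechet_derivative f (at x) h))"

text \<open>\<open>C\<^sub>c\<^sup>\<infinity>(U)\<close>, with its elements extended by zero to the whole space.\<close>

definition test_functions :: "'a::euclidean_space set \<Rightarrow> ('a \<Rightarrow> real) set" where
  "test_functions U =
     {\<eta>. (\<forall>k. Ck k \<eta>) \<and> compact (closure {x. \<eta> x \<noteq> 0}) \<and> closure {x. \<eta> x \<noteq> 0} \<subseteq> U}"

text \<open>Integrability is required explicitly because the library integral of a non-integrable function
  is \<open>0\<close>. The values of \<open>v\<close> at times outside \<open>I\<close> are irrelevant.\<close>

definition frac_heat_weak_solution ::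
    "real \<Rightarrow> real set \<Rightarrow> 'a::euclidean_space set \<Rightarrow> (real \<times> 'a \<Rightarrow> real) \<Rightarrow> bool" where
  "frac_heat_weak_solution s I \<Omega> v \<longleftrightarrow>
     (\<forall>\<eta> \<in> test_functions (I \<times> \<Omega>).
        let F = (\<lambda>(t, x). v (t, x) *
                   (- deriv (\<lambda>\<tau>. \<eta> (\<tau>, x)) t + frac_lap s (\<lambda>z. \<eta> (t, z)) x))
        in set_integrable lborel (I \<times> UNIV) F \<and>
           set_lebesgue_integral lborel (I \<times> UNIV) F = 0)"

section \<open>Hoelder spaces\<close>

text \<open>The sup norm agrees with the \<open>L\<^sup>\<infinity>\<close> norm on open sets \<open>I \<times> D\<close>, since a function with finite
  second term is continuous.\<close>

definition holder_tx_norm ::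
    "real \<Rightarrow> real \<Rightarrow> real set \<Rightarrow> 'a::euclidean_space set \<Rightarrow> (real \<times> 'a \<Rightarrow> real) \<Rightarrow> ennreal" where
  "holder_tx_norm \<beta> \<alpha> I D u =
     (SUP p \<in> I \<times> D. ennreal \<bar>u p\<bar>) +
     (SUP ((t, x), (t', x')) \<in> {(p, q). p \<in> I \<times> D \<and> q \<in> I \<times> D \<and> p \<noteq> q}.
        ennreal (\<bar>u (t, x) - u (t', x')\<bar> / (\<bar>t - t'\<bar> powr \<beta> + norm (x - x') powr \<alpha>)))"

definition holder_tx ::
    "real \<Rightarrow> real \<Rightarrow> real set \<Rightarrow> 'a::euclidean_space set \<Rightarrow> (real \<times> 'a \<Rightarrow> real) set" where
  "holder_tx \<beta> \<alpha> I D = {u. holder_tx_norm \<beta> \<alpha> I D u < \<infinity>}"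

text \<open>The \<open>C\<^sup>k\<^sup>,\<^sup>\<theta>(I)\<close> norm, for open \<open>I\<close>; it is infinite on functions that are not \<open>C\<^sup>k\<close>.\<close>

definition holder_norm :: "nat \<Rightarrow> real \<Rightarrow> real set \<Rightarrow> (real \<Rightarrow> real) \<Rightarrow> ennreal" where
  "holder_norm k \<theta> I f =
     (if (\<forall>j<k. \<forall>t\<in>I. (deriv ^^ j) f differentiable (at t)) \<and> continuous_on I ((deriv ^^ k) f)
      then (\<Sum>j\<le>k. SUP t\<in>I. ennreal \<bar>(deriv ^^ j) f t\<bar>) +
           (SUP (t, t') \<in> {(t, t'). t \<in> I \<and> t' \<in> I \<and> t \<noteq> t'}.
              ennreal (\<bar>(deriv ^^ k) f t - (deriv ^^ k) f t'\<bar> / \<bar>t - t'\<bar> powr \<theta>))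
      else \<infinity>)"

definition holder_t ::
    "real \<Rightarrow> real set \<Rightarrow> 'a::euclidean_space set \<Rightarrow> (real \<times> 'a \<Rightarrow> real) set" where
  "holder_t \<gamma> I D =
     {u. (SUP x\<in>D. holder_norm (nat \<lfloor>\<gamma>\<rfloor>) (\<gamma> - of_int \<lfloor>\<gamma>\<rfloor>) I (\<lambda>t. u (t, x))) < \<infinity>}"

end

theory Submission
  imports Defs
begin

text \<open>
  Let \<open>g(r) = \<Sum> b\<^sub>k cos (k r)\<close> be a nonnegative even periodic function vanishing for \<open>|r| \<le> \<pi>/2\<close>, let \<open>e\<close>
  be a unit vector, and let \<open>f\<close> be a function of time that is Hoelder continuous of order
  \<open>\<beta> = \<alpha>/(2s) - \<epsilon>\<close> and no better at one time. If \<open>u\<close> solves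
  \<open>\<partial>\<^sub>t u + (-\<Delta>)\<^sup>s u = f(t) g(e \<bullet> x)\<close> with zero initial values, then \<open>v = \<partial>\<^sub>t u\<close> solves the same
  equation with right-hand side \<open>f'(t) g(e \<bullet> x)\<close>, which vanishes in \<open>B\<^sub>1\<close>. Explicitly,
  \<open>v = \<Sum> b\<^sub>k (f - W\<^sub>k)(t) cos (k e \<bullet> x)\<close>, where \<open>W\<^sub>k' = m\<^sub>k (f - W\<^sub>k)\<close>, \<open>W\<^sub>k(-1) = 0\<close>, and \<open>m\<^sub>k\<close> is
  the symbol of \<open>(-\<Delta>)\<^sup>s\<close> at \<open>k e\<close>. A comparison principle for this relaxation equation shows
  that \<open>W\<^sub>k\<close> is as Hoelder continuous as \<open>f\<close>, uniformly in \<open>k\<close>. At \<open>x = 0\<close> the identity \<open>g(0) = 0\<close>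
  leaves \<open>\<partial>\<^sub>t v = - A f + Lipschitz\<close> with \<open>A = \<Sum> b\<^sub>k m\<^sub>k = (-\<Delta>)\<^sup>s (g(e \<bullet> -))(0) < 0\<close>, so \<open>\<partial>\<^sub>t v\<close> inherits
  the irregularity of \<open>f\<close>.
\<close>

section \<open>Cosine series\<close>

text \<open>By the three-term Chebyshev recurrence, cos (k x) is a polynomial in cos x. This lets an
  expansion on [0, pi] be carried over to the whole line.\<close>

lemma cos_multiple_cong:
  fixes x y :: real
  assumes "cos y = cos x"
  shows "cos (real k * y) = cos (real k * x)"
proof (induction k rule: induct_nat_012)
  case (ge2 n)
  have "cos (real (Suc (Suc n)) * z) = 2 * cos z * cos (real (Suc n) * z) - cos (real n * z)" for z :: real
  proof -
    have "cos (real (Suc (Suc n)) * z) + cos (real n * z) = 2 * cos z * cos (real (Suc n) * z)"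
      using cos_add[of "real (Suc n) * z" z] cos_diff[of "real (Suc n) * z" z]
      by (simp add: algebra_simps)
    then show ?thesis by simp
  qed
  then show ?case using ge2 assms by simp
qed (use assms in auto)

text \<open>Powers of cos x reduce to multiples: 2 cos x cos (k x) = cos ((k+1) x) + cos ((k-1) x),
  so orthogonality to every cos (k x) passes to cos x ^ j cos (k x) by induction on j, for all k at
  once.\<close>

lemma integral_times_cos_polynomial_eq_0:
  fixes D :: "real \<Rightarrow> real"
  assumes D: "continuous_on {0..pi} D"
    and orth: "\<And>k::nat. integral {0..pi} (\<lambda>x. D x * cos (real k * x)) = 0"
    and p: "real_polynomial_function p"
  shows "integral {0..pi} (\<lambda>x. D x * p (cos x)) = 0"
proof -
  have int: "(\<lambda>x. D x * (cos x ^ j * cos (real k * x))) integrable_on {0..pi}" for j k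
    by (intro integrable_continuous_interval continuous_intros D)
  have mono: "integral {0..pi} (\<lambda>x. D x * (cos x ^ j * cos (real k * x))) = 0" for j k
  proof (induction j arbitrary: k)
    case 0
    then show ?case using orth[of k] by simp
  next
    case (Suc j)
    \<comment> \<open>\<open>k'\<close> is the absolute value of k - 1. Truncated subtraction would
      give 0 at k = 0, while cos (-x) = cos x calls for 1.\<close>
    define k' where "k' = (if k = 0 then 1 else k - 1)"
    have *: "cos x ^ Suc j * cos (real k * x)
        = (1/2) * (cos x ^ j * cos (real (Suc k) * x)) + (1/2) * (cos x ^ j * cos (real k' * x))" for x :: real
    proof -
      have "cos (real k' * x) = cos (real k * x - x)"
        by (auto simp: k'_def of_nat_diff algebra_simps)
      moreover have "cos (real (Suc k) * x) + cos (real k * x - x) = 2 * (cos x * cos (real k * x))"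
        using cos_add[of "real k * x" x] cos_diff[of "real k * x" x]
        by (simp add: algebra_simps)
      ultimately have "cos x * cos (real k * x) = (1/2) * cos (real (Suc k) * x) + (1/2) * cos (real k' * x)"
        by simp
      then have "cos x ^ j * (cos x * cos (real k * x))
          = cos x ^ j * ((1/2) * cos (real (Suc k) * x) + (1/2) * cos (real k' * x))"
        by simp
      then show ?thesis by (simp add: algebra_simps)
    qed
    have "integral {0..pi} (\<lambda>x. D x * (cos x ^ Suc j * cos (real k * x)))
       = integral {0..pi} (\<lambda>x. (1/2) * (D x * (cos x ^ j * cos (real (Suc k) * x)))
            + (1/2) * (D x * (cos x ^ j * cos (real k' * x))))"
      unfolding * by (simp only: algebra_simps)
    also have "\<dots> = 0"
      using int[of j "Suc k"] int[of j k'] Suc.IH[of "Suc k"] Suc.IH[of k']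
      by (subst integral_add) (auto simp del: of_nat_Suc intro: integrable_on_cmult_left)
    finally show ?case .
  qed
  obtain a n where an: "p = (\<lambda>x. \<Sum>i\<le>n. a i * x ^ i)"
    using p unfolding real_polynomial_function_iff_sum by blast
  have "integral {0..pi} (\<lambda>x. D x * p (cos x)) = integral {0..pi} (\<lambda>x. \<Sum>i\<le>n. a i * (D x * (cos x ^ i * cos (real 0 * x))))"
    unfolding an by (simp add: sum_distrib_left mult_ac)
  also have "\<dots> = (\<Sum>i\<le>n. integral {0..pi} (\<lambda>x. a i * (D x * (cos x ^ i * cos (real 0 * x)))))"
    by (intro integral_sum integrable_continuous_interval continuous_intros D) auto
  also have "\<dots> = 0"
    using mono[of _ 0] by simp
  finally show ?thesis .
qed

text \<open>Under u = cos x the function \<open>D\<close> becomes continuous on [-1,1] and is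
  uniformly approximated there by polynomials. As \<open>D\<close> is orthogonal to each p(cos x),
  the integral of its square is at most the approximation error times its L1 norm, hence
  zero.\<close>

lemma cosine_orthogonal_imp_zero:
  fixes D :: "real \<Rightarrow> real"
  assumes D: "continuous_on {0..pi} D"
    and orth: "\<And>k::nat. integral {0..pi} (\<lambda>x. D x * cos (real k * x)) = 0"
    and x: "x \<in> {0..pi}"
  shows "D x = 0"
proof -
  define I where "I = integral {0..pi} (\<lambda>x. D x * D x)"
  define J where "J = integral {0..pi} (\<lambda>x. \<bar>D x\<bar>)"
  have J: "J \<ge> 0" unfolding J_def
    by (intro integral_nonneg integrable_continuous_interval continuous_intros D) auto
  have "I \<le> 0"
  proof (rule field_le_epsilon)
    fix e :: real assume "e > 0"
    \<comment> \<open>The added 1 keeps the tolerance meaningful when \<open>J\<close> is 0, and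
      still gives \<open>d * J\<close> at most \<open>e\<close>.\<close>
    define d where "d = e / (J + 1)"
    have d: "d > 0" using \<open>e > 0\<close> J by (simp add: d_def)
    have "continuous_on {-1..1} (\<lambda>u. D (arccos u))"
      by (rule continuous_on_compose2[OF D]) (auto intro!: continuous_intros arccos_lbound arccos_ubound)
    then obtain p where p: "real_polynomial_function p" "\<And>u. u \<in> {-1..1} \<Longrightarrow> \<bar>D (arccos u) - p u\<bar> < d"
      using Stone_Weierstrass_real_polynomial_function[OF _ _ d, of "{-1..1}"] by auto
    have close: "\<bar>D y - p (cos y)\<bar> \<le> d" if "y \<in> {0..pi}" for y
      using p(2)[of "cos y"] that by (auto simp: arccos_cos intro: less_imp_le)
    have pc: "continuous_on {0..pi} (\<lambda>y. p (cos y))"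
      by (rule continuous_on_compose2[OF continuous_on_polymonial_function[of p UNIV]])
        (auto intro!: continuous_intros simp: real_polynomial_function_eq[symmetric] p)
    have "I = integral {0..pi} (\<lambda>y. D y * D y) - integral {0..pi} (\<lambda>y. D y * p (cos y))"
      using integral_times_cos_polynomial_eq_0[OF D orth p(1)] by (simp add: I_def)
    also have "\<dots> = integral {0..pi} (\<lambda>y. D y * D y - D y * p (cos y))"
      by (subst integral_diff) (auto intro!: integrable_continuous_interval continuous_intros D pc)
    also have "\<dots> \<le> integral {0..pi} (\<lambda>y. d * \<bar>D y\<bar>)"
    proof (rule integral_le)
      fix y assume y: "y \<in> {0..pi}"
      have "D y * D y - D y * p (cos y) \<le> \<bar>D y\<bar> * \<bar>D y - p (cos y)\<bar>"
        by (metis abs_ge_self abs_mult right_diff_distrib)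
      also have "\<dots> \<le> \<bar>D y\<bar> * d" using close[OF y] by (intro mult_left_mono) auto
      finally show "D y * D y - D y * p (cos y) \<le> d * \<bar>D y\<bar>" by (simp add: mult.commute)
    qed (auto intro!: integrable_continuous_interval continuous_intros D pc)
    also have "\<dots> = d * J" by (simp add: J_def)
    also have "\<dots> \<le> 0 + e" using J \<open>e > 0\<close> by (simp add: d_def field_simps)
    finally show "I \<le> 0 + e" .
  qed
  moreover have "I \<ge> 0" unfolding I_def
    by (intro integral_nonneg integrable_continuous_interval continuous_intros D) auto
  ultimately have "integral {0..pi} (\<lambda>x. D x * D x) = 0" by (simp add: I_def)
  then have "((\<lambda>x. D x * D x) has_integral 0) {0..pi}"
    by (metis D continuous_on_mult integrable_continuous_interval integrable_integral)
  then have "D x * D x = 0"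
    using has_integral_0_cbox_imp_0[of 0 pi "\<lambda>x. D x * D x" x] x D pi_gt_zero
    by (auto intro!: continuous_intros)
  then show ?thesis by simp
qed

lemma integral_cos_mult_cos:
  "integral {0..pi} (\<lambda>x. cos (real j * x) * cos (real k * x)) = (if j = k then if k = 0 then pi else pi / 2 else 0)"
proof -
  have c: "((\<lambda>x. cos (a * x)) has_integral (if a = 0 then pi else 0)) {0..pi}" if "a \<in> \<int>" for a :: real
  proof (cases "a = 0")
    case True
    then show ?thesis using has_integral_const_real[of "1::real" 0 pi] by simp
  next
    case False
    have "((\<lambda>x. cos (a * x)) has_integral (sin (a * pi) / a - sin (a * 0) / a)) {0..pi}"
      by (rule fundamental_theorem_of_calculus)
        (use False in \<open>auto intro!: derivative_eq_intros simp: has_real_derivative_iff_has_vector_derivative[symmetric]\<close>)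
    moreover have "sin (a * pi) = 0"
      using that by (metis mult.commute sin_npi_int Ints_cases)
    ultimately show ?thesis using False by simp
  qed
  have "cos (real j * x) * cos (real k * x) = (1/2) * cos ((real j - real k) * x) + (1/2) * cos ((real j + real k) * x)" for x
    using cos_add[of "real j * x" "real k * x"] cos_diff[of "real j * x" "real k * x"]
    by (simp add: algebra_simps)
  moreover have "((\<lambda>x. (1/2) * cos ((real j - real k) * x) + (1/2) * cos ((real j + real k) * x)) has_integral
     ((1/2) * (if real j - real k = 0 then pi else 0) + (1/2) * (if real j + real k = 0 then pi else 0))) {0..pi}"
    by (intro has_integral_add has_integral_mult_right c) auto
  ultimately have "((\<lambda>x. cos (real j * x) * cos (real k * x)) has_integral
     ((1/2) * (if real j - real k = 0 then pi else 0) + (1/2) * (if real j + real k = 0 then pi else 0))) {0..pi}"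
    by (simp only:)
  then show ?thesis by (auto dest!: integral_unique)
qed

text \<open>Absolute summability makes the series converge uniformly to a continuous
  \<open>G\<close>. Termwise integration shows that \<open>G\<close> and \<open>g\<close> have the
  same cosine coefficients, so their difference is orthogonal to all cosines and vanishes.\<close>

lemma cosine_series_sums:
  fixes g :: "real \<Rightarrow> real"
  assumes g: "continuous_on {0..pi} g"
    and b: "\<And>k. b k = (if k = 0 then 1 / pi else 2 / pi) * integral {0..pi} (\<lambda>x. g x * cos (real k * x))"
    and sm: "summable (\<lambda>k. \<bar>b k\<bar>)"
    and x: "x \<in> {0..pi}"
  shows "(\<lambda>k. b k * cos (real k * x)) sums g x"
proof -
  define G where "G = (\<lambda>x. \<Sum>k. b k * cos (real k * x))"
  have sm': "summable (\<lambda>k. b k * cos (real k * y))" for y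
    by (rule summable_comparison_test'[OF sm, of 0]) (auto simp: abs_mult intro: mult_left_le)
  have unif: "uniform_limit {0..pi} (\<lambda>n y. \<Sum>k<n. b k * cos (real k * y)) G sequentially" unfolding G_def
    by (rule Weierstrass_m_test[OF _ sm]) (auto simp: abs_mult intro: mult_left_le)
  have G: "continuous_on {0..pi} G"
    by (rule uniform_limit_theorem[OF _ unif]) (auto intro!: continuous_intros always_eventually)
  have coeff: "integral {0..pi} (\<lambda>y. G y * cos (real j * y)) = integral {0..pi} (\<lambda>y. g y * cos (real j * y))" for j
  proof -
    have "uniform_limit {0..pi} (\<lambda>n y. (\<Sum>k<n. b k * cos (real k * y)) * cos (real j * y)) (\<lambda>y. G y * cos (real j * y)) sequentially"
      by (rule uniform_lim_mult[OF unif uniform_limit_const])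
        (auto intro!: compact_imp_bounded compact_continuous_image continuous_intros G)
    then obtain I L where I: "\<And>n. ((\<lambda>y. (\<Sum>k<n. b k * cos (real k * y)) * cos (real j * y)) has_integral I n) {0..pi}"
      and L: "((\<lambda>y. G y * cos (real j * y)) has_integral L) {0..pi}" "I \<longlonglongrightarrow> L"
      by (rule uniform_limit_integral) (auto intro!: continuous_intros)
    \<comment> \<open>Once the partial sum contains the index j, its j-th coefficient no longer
      changes, so the sequence \<open>I\<close> is eventually constant.\<close>
    have "I n = integral {0..pi} (\<lambda>y. g y * cos (real j * y))" if "n > j" for n
    proof -
      have "I n = integral {0..pi} (\<lambda>y. \<Sum>k<n. b k * (cos (real k * y) * cos (real j * y)))"
        using I[of n] by (simp add: integral_unique sum_distrib_right mult.assoc)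
      also have "\<dots> = (\<Sum>k<n. b k * integral {0..pi} (\<lambda>y. cos (real k * y) * cos (real j * y)))"
        by (subst integral_sum) (auto intro!: integrable_continuous_interval continuous_intros)
      also have "\<dots> = (\<Sum>k<n. if k = j then b j * (if j = 0 then pi else pi / 2) else 0)"
        by (intro sum.cong) (auto simp: integral_cos_mult_cos)
      also have "\<dots> = b j * (if j = 0 then pi else pi / 2)" using that by simp
      finally show ?thesis by (simp add: b)
    qed
    then have "I \<longlonglongrightarrow> integral {0..pi} (\<lambda>y. g y * cos (real j * y))"
      by (intro tendsto_eventually eventually_sequentiallyI[of "Suc j"]) auto
    with L show ?thesis using LIMSEQ_unique integral_unique by metis
  qed
  have "g x - G x = 0"
  proof (rule cosine_orthogonal_imp_zero[OF _ _ x, of "\<lambda>y. g y - G y"])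
    show "continuous_on {0..pi} (\<lambda>y. g y - G y)" by (intro continuous_intros g G)
    show "integral {0..pi} (\<lambda>x. (g x - G x) * cos (real k * x)) = 0" for k
      using coeff[of k] by (simp add: left_diff_distrib)
        (subst integral_diff, auto intro!: integrable_continuous_interval continuous_intros g G)
  qed
  then show ?thesis using summable_sums[OF sm'[of x]] by (simp add: G_def)
qed

text \<open>Integrating by parts twice; at \<open>\<pi>\<close> the boundary terms vanish because of the factor \<open>sin\<close>.\<close>

lemma integral_cos_power_cos_recursion:
  fixes k N :: nat
  assumes "N \<ge> 2"
  defines "c \<equiv> \<lambda>N. integral {pi/2..pi} (\<lambda>x. cos x ^ N * cos (real k * x))"
  shows "((real k)\<^sup>2 - (real N)\<^sup>2) * c N = - (real N * real (N - 1) * c (N - 2))"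
proof -
  \<comment> \<open>With u = cos x ^ N and w = cos (k x) this is u' w - u w', so its derivative is
    u'' w - u w''. At pi/2 the powers of cos vanish because N is at least 2; at pi both sines
    vanish.\<close>
  define F where "F x = real k * cos x ^ N * sin (real k * x) - real N * cos x ^ (N - 1) * sin x * cos (real k * x)" for x
  obtain M where M: "N = Suc (Suc M)" using assms(1) by (metis add_2_eq_Suc le_Suc_ex)
  have "((\<lambda>x. ((real k)\<^sup>2 - (real N)\<^sup>2) * (cos x ^ N * cos (real k * x))
         + real N * real (N - 1) * (cos x ^ (N - 2) * cos (real k * x))) has_integral (F pi - F (pi/2))) {pi/2..pi}"
  proof (rule fundamental_theorem_of_calculus)
    fix x :: real
    have s: "sin x * (sin x * z) = z - cos x * (cos x * z)" for z
      by (metis (no_types) sin_squared_eq power2_eq_square left_diff_distrib mult.assoc mult.left_neutral)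
    have "(F has_real_derivative ((real k)\<^sup>2 - (real N)\<^sup>2) * (cos x ^ N * cos (real k * x))
         + real N * real (N - 1) * (cos x ^ (N - 2) * cos (real k * x))) (at x within {pi/2..pi})"
      unfolding F_def
      by (rule derivative_eq_intros refl)+ (simp add: M s power2_eq_square algebra_simps)
    then show "(F has_vector_derivative ((real k)\<^sup>2 - (real N)\<^sup>2) * (cos x ^ N * cos (real k * x))
         + real N * real (N - 1) * (cos x ^ (N - 2) * cos (real k * x))) (at x within {pi/2..pi})"
      by (simp add: has_real_derivative_iff_has_vector_derivative)
  qed auto
  moreover have "F pi - F (pi/2) = 0" by (simp add: F_def M)
  ultimately have "integral {pi/2..pi} (\<lambda>x. ((real k)\<^sup>2 - (real N)\<^sup>2) * (cos x ^ N * cos (real k * x))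
         + real N * real (N - 1) * (cos x ^ (N - 2) * cos (real k * x))) = 0"
    by (simp add: integral_unique)
  then have "((real k)\<^sup>2 - (real N)\<^sup>2) * c N + real N * real (N - 1) * c (N - 2) = 0"
    unfolding c_def by (subst (asm) integral_add) (auto intro!: integrable_continuous_interval continuous_intros)
  then show ?thesis by simp
qed

text \<open>With the sixth power the coefficients are \<open>O(k\<^sup>-\<^sup>6)\<close>, which beats the square \<open>O(k\<^sup>4)\<close> of the symbol.\<close>

definition bump :: "real \<Rightarrow> real" where
  "bump r = max 0 (- cos r) ^ 6"

text \<open>On [0, pi] the function \<open>bump\<close> is supported in [pi/2, pi] and equals cos ^
  6 there. Three uses of the recursion take the power from 6 to 0, each gaining a factor of order
  k^-2, so after multiplication by the weight (k+1)^4 terms of order k^-2 remain.\<close>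

lemma bump_cosine_series:
  obtains b :: "nat \<Rightarrow> real"
  where "summable (\<lambda>k. \<bar>b k\<bar> * real (Suc k) ^ 4)"
    and "\<And>x. (\<lambda>k. b k * cos (real k * x)) sums bump x"
proof -
  define c where "c N k = integral {pi/2..pi} (\<lambda>x. cos x ^ N * cos (real k * x))" for N k :: nat
  define b where "b k = (if k = 0 then 1 / pi else 2 / pi) * integral {0..pi} (\<lambda>x. bump x * cos (real k * x))" for k :: nat
  have cont: "continuous_on A bump" for A
    unfolding bump_def by (intro continuous_intros)
  have bc: "integral {0..pi} (\<lambda>x. bump x * cos (real k * x)) = c 6 k" for k
  proof -
    have "integral {0..pi} (\<lambda>x. bump x * cos (real k * x))
        = integral {0..pi/2} (\<lambda>x. bump x * cos (real k * x)) + integral {pi/2..pi} (\<lambda>x. bump x * cos (real k * x))"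
      by (rule Henstock_Kurzweil_Integration.integral_combine[symmetric])
        (auto intro!: integrable_continuous_interval continuous_intros cont)
    also have "integral {0..pi/2} (\<lambda>x. bump x * cos (real k * x)) = integral {0..pi/2} (\<lambda>x. 0)"
      by (rule integral_cong) (auto simp: bump_def max_def intro!: cos_ge_zero antisym)
    also have "integral {pi/2..pi} (\<lambda>x. bump x * cos (real k * x)) = c 6 k"
      unfolding c_def
    proof (rule integral_cong)
      fix x assume "x \<in> {pi/2..pi}"
      then have "cos x \<le> 0" using cos_monotone_0_pi_le[of "pi/2" x] by simp
      then show "bump x * cos (real k * x) = cos x ^ 6 * cos (real k * x)"
        by (simp add: bump_def max_def)
    qed
    finally show ?thesis by simp
  qed
  \<comment> \<open>The constant is 120^3 * 64. Here 120 = 4 * 30, where 30 = 6 * 5 bounds N (N - 1)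
    and 4 comes from bounding the absolute value of k^2 - N^2 below by k^2 / 4, valid for k >= 7 and
    N <= 6. The factor 64 comes from (k+1)^6 <= (2k)^6.\<close>
  have bound: "\<bar>b k\<bar> * real (Suc k) ^ 4 \<le> 110592000 * (1 / real (Suc k) ^ 2)" if k: "k \<ge> 7" for k
  proof -
    have rec: "\<bar>c N k\<bar> \<le> 120 / (real k)\<^sup>2 * \<bar>c (N - 2) k\<bar>" if "2 \<le> N" "N \<le> 6" for N
    proof -
      have k7: "49 \<le> (real k)\<^sup>2" using k power_mono[of 7 "real k" 2] by simp
      have N6: "(real N)\<^sup>2 \<le> 36" using that power_mono[of "real N" 6 2] by simp
      have "(real k)\<^sup>2 / 4 \<le> \<bar>(real k)\<^sup>2 - (real N)\<^sup>2\<bar>" using k7 N6 by linarith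
      then have "(real k)\<^sup>2 / 4 * \<bar>c N k\<bar> \<le> \<bar>((real k)\<^sup>2 - (real N)\<^sup>2) * c N k\<bar>"
        unfolding abs_mult by (intro mult_right_mono) auto
      also have "\<dots> = real N * real (N - 1) * \<bar>c (N - 2) k\<bar>"
        using integral_cos_power_cos_recursion[OF that(1), of k] by (simp add: c_def abs_mult)
      also have "\<dots> \<le> (6 * 5) * \<bar>c (N - 2) k\<bar>"
        using that by (intro mult_right_mono mult_mono) auto
      finally show ?thesis using k by (simp add: field_simps)
    qed
    have "\<bar>c 0 k\<bar> \<le> pi / 2"
    proof -
      have "norm (integral {pi/2..pi} (\<lambda>x. cos x ^ 0 * cos (real k * x))) \<le> integral {pi/2..pi} (\<lambda>x. 1)"
        by (intro integral_norm_bound_integral) (auto intro!: integrable_continuous_interval continuous_intros)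
      then show ?thesis by (simp add: c_def)
    qed
    define q where "q = 120 / (real k)\<^sup>2"
    have q: "q \<ge> 0" by (simp add: q_def)
    have "\<bar>c 6 k\<bar> \<le> q * \<bar>c 4 k\<bar>" "\<bar>c 4 k\<bar> \<le> q * \<bar>c 2 k\<bar>" "\<bar>c 2 k\<bar> \<le> q * \<bar>c 0 k\<bar>"
      using rec[of 6] rec[of 4] rec[of 2] by (simp_all add: q_def)
    with \<open>\<bar>c 0 k\<bar> \<le> pi / 2\<close> q have "\<bar>c 6 k\<bar> \<le> q * (q * (q * (pi / 2)))"
      by (meson mult_left_mono order_trans)
    then have "\<bar>b k\<bar> \<le> 2 / pi * (q * (q * (q * (pi / 2))))"
      using k by (simp add: b_def bc abs_mult) (simp add: field_simps)
    also have "\<dots> = q ^ 3" by (simp add: power3_eq_cube)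
    finally have b6: "\<bar>b k\<bar> \<le> 1728000 / real k ^ 6"
      using k by (simp add: q_def power_divide power_mult[symmetric])
    have "real (Suc k) ^ 6 \<le> (2 * real k) ^ 6"
      using k by (intro power_mono) auto
    then have k6: "real (Suc k) ^ 6 \<le> 64 * real k ^ 6" by (simp add: power_mult_distrib)
    have "\<bar>b k\<bar> * real (Suc k) ^ 6 \<le> 1728000 / real k ^ 6 * (64 * real k ^ 6)"
      using b6 k6 by (intro mult_mono) auto
    also have "\<dots> = 110592000" using k by simp
    finally have "\<bar>b k\<bar> * (real (Suc k) ^ 4 * real (Suc k) ^ 2) \<le> 110592000"
      by (simp only: power_add[symmetric]) simp
    then show ?thesis
      by (simp add: pos_le_divide_eq mult.assoc del: of_nat_Suc)
  qed
  have "summable (\<lambda>k. 110592000 * (1 / real (Suc k) ^ 2))"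
    using inverse_power_summable[of 2, where 'a=real]
    by (intro summable_mult) (subst summable_Suc_iff, simp add: inverse_eq_divide)
  then have sm: "summable (\<lambda>k. \<bar>b k\<bar> * real (Suc k) ^ 4)"
    by (rule summable_comparison_test'[of _ 7]) (use bound in auto)
  have sm1: "summable (\<lambda>k. \<bar>b k\<bar>)"
    by (rule summable_comparison_test'[OF sm, of 0])
     (auto intro!: mult_le_cancel_left1[THEN iffD2] one_le_power)
  have "(\<lambda>k. b k * cos (real k * x)) sums bump x" for x
  proof -
    \<comment> \<open>Folds an arbitrary point into [0, pi]; both sides of the expansion depend on x
      only through cos x.\<close>
    define y where "y = arccos (cos x)"
    have y: "y \<in> {0..pi}" "cos y = cos x"
      by (auto simp: y_def arccos_lbound arccos_ubound)
    have "(\<lambda>k. b k * cos (real k * y)) sums bump y"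
      by (rule cosine_series_sums[OF cont b_def sm1 y(1)])
    then show ?thesis
      using y by (simp add: cos_multiple_cong[OF y(2)] bump_def)
  qed
  with sm show thesis using that by blast
qed

section \<open>The Levy kernel and the symbol\<close>

text \<open>A ball of radius \<open>r j\<close> has volume proportional to
  \<open>r j ^ DIM('a)\<close>, so the j-th bound contributes a constant multiple of
  \<open>a j\<close>. Covering by balls in this way takes the place of polar coordinates.\<close>

lemma integrable_dyadic_bound:
  fixes k :: "'a::euclidean_space \<Rightarrow> real"
  assumes [measurable]: "k \<in> borel_measurable borel"
    and k0: "\<And>y. k y \<ge> 0"
    and r: "\<And>j. r j > 0" and a: "\<And>j. a j \<ge> 0" and sm: "summable a"
    and bnd: "\<And>y. k y \<noteq> 0 \<Longrightarrow> \<exists>j::nat. norm y < r j \<and> k y \<le> a j / r j ^ DIM('a)"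
  shows "integrable lborel k"
proof (rule integrableI_nonneg)
  have [measurable]: "ball (0::'a) q \<in> sets borel" for q
    by (rule borel_open[OF open_ball])
  define w where "w = measure lborel (ball (0::'a) 1)"
  have "(\<integral>\<^sup>+y. ennreal (k y) \<partial>lborel)
     \<le> (\<integral>\<^sup>+y. (\<Sum>j. ennreal (a j / r j ^ DIM('a)) * indicator (ball (0::'a) (r j)) y) \<partial>lborel)"
  proof (rule nn_integral_mono)
    fix y :: 'a
    show "ennreal (k y) \<le> (\<Sum>j. ennreal (a j / r j ^ DIM('a)) * indicator (ball (0::'a) (r j)) y)"
    proof (cases "k y = 0")
      case False
      then obtain j where j: "norm y < r j" "k y \<le> a j / r j ^ DIM('a)" using bnd by blast
      define G where "G i = ennreal (a i / r i ^ DIM('a)) * indicator (ball (0::'a) (r i)) y" for i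
      have "ennreal (k y) \<le> G j"
        using j by (simp add: G_def ennreal_leI)
      also have "\<dots> = (\<Sum>i\<in>{j}. G i)" by simp
      also have "\<dots> \<le> (\<Sum>i. G i)"
        by (rule sum_le_suminf) auto
      finally show ?thesis by (simp only: G_def)
    qed simp
  qed
  also have "\<dots> = (\<Sum>j. \<integral>\<^sup>+y. ennreal (a j / r j ^ DIM('a)) * indicator (ball (0::'a) (r j)) y \<partial>lborel)"
    by (rule nn_integral_suminf) measurable
  also have "\<dots> = (\<Sum>j. ennreal (a j * w))"
  proof (rule suminf_cong)
    fix j
    have "emeasure lborel (ball (0::'a) (r j)) = ennreal (measure lborel (ball (0::'a) (r j)))"
      by (rule emeasure_eq_ennreal_measure) (use emeasure_lborel_ball_finite[of "0::'a" "r j"] in auto)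
    also have "measure lborel (ball (0::'a) (r j)) = r j ^ DIM('a) * w"
      unfolding w_def using r[of j] by (intro content_ball_conv_unit_ball) auto
    finally show "(\<integral>\<^sup>+y. ennreal (a j / r j ^ DIM('a)) * indicator (ball (0::'a) (r j)) y \<partial>lborel) = ennreal (a j * w)"
      using r[of j] a[of j] by (simp add: nn_integral_cmult_indicator ennreal_mult'[symmetric])
  qed
  also have "\<dots> < \<infinity>"
    using sm a by (subst suminf_ennreal2) (auto simp: w_def intro: summable_mult2)
  finally show "(\<integral>\<^sup>+y. ennreal (k y) \<partial>lborel) < \<infinity>" .
qed (use k0 in auto)

lemma dyadic_interval_exists:
  fixes x :: real
  assumes "x \<ge> 1"
  shows "\<exists>j. 2 ^ j \<le> x \<and> x < 2 ^ Suc j"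
proof -
  obtain j where j: "x < 2 ^ j" using real_arch_pow[of 2 x] by auto
  define n where "n = (LEAST j. x < 2 ^ j)"
  have n: "x < 2 ^ n" unfolding n_def by (rule LeastI[of _ j]) (rule j)
  have "n \<noteq> 0" using n assms by (intro notI) simp
  then obtain i where i: "n = Suc i" by (cases n) auto
  then have "\<not> x < 2 ^ i" using not_less_Least[of i "\<lambda>j. x < 2 ^ j"] n_def by simp
  with n i show ?thesis by (intro exI[of _ i]) auto
qed

text \<open>Decomposition into dyadic shells. Far from 0 the j-th shell contributes a multiple of
  2^(-2 s j), summable because s > 0; near 0 the numerator improves this to a multiple of 2^(-(2 - 2
  s) j), summable because s < 1.\<close>

lemma integrable_levy_kernel:
  assumes s: "0 < s" "s < 1"
  shows "integrable lborel (\<lambda>y::'a::euclidean_space. min 1 ((norm y)\<^sup>2) / norm y powr (real DIM('a) + 2 * s))"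
    (is "integrable lborel ?k")
proof -
  define n where "n = DIM('a)"
  have geo: "summable (\<lambda>j. C * (2 powr (- q)) ^ j)" if "q > 0" for C q :: real
    using that by (intro summable_mult summable_geometric) (simp add: powr_less_one)
  have pw: "(2 ^ j) powr q = (2 powr q) ^ j" for j :: nat and q :: real
    by (simp add: powr_powr powr_realpow[symmetric] mult.commute del: powr_realpow)
  have big: "integrable lborel (\<lambda>y::'a. ?k y * indicator {y. norm y \<ge> 1} y)"
  \<comment> \<open>The kernel is estimated at the inner radius 2^j of a shell and the volume at the
    outer radius 2^(j+1); the ratio 2 of the radii produces the factor \<open>2 ^ n\<close>.\<close>
  proof (rule integrable_dyadic_bound[where r = "\<lambda>j. 2 ^ Suc j" and a = "\<lambda>j. 2 ^ n * (2 powr (- (2 * s))) ^ j"])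
    fix y :: 'a
    assume "?k y * indicator {y. norm y \<ge> 1} y \<noteq> 0"
    then have y: "norm y \<ge> 1" by (auto simp: indicator_def split: if_splits)
    show "\<exists>j. norm y < 2 ^ Suc j \<and> ?k y * indicator {y. norm y \<ge> 1} y \<le> 2 ^ n * (2 powr (- (2 * s))) ^ j / (2 ^ Suc j) ^ DIM('a)"
    proof -
      obtain j where j: "2 ^ j \<le> norm y" "norm y < 2 ^ Suc j" using dyadic_interval_exists[OF y] by blast
      have "?k y * indicator {y. norm y \<ge> 1} y = 1 / (norm y ^ n * norm y powr (2 * s))"
        using y by (simp add: min_def n_def powr_add powr_realpow)
          (simp add: powr_realpow[OF less_le_trans[OF zero_less_one y]])
      also have "\<dots> \<le> 1 / ((2 ^ j) ^ n * (2 ^ j) powr (2 * s))"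
        using j s y by (intro divide_left_mono mult_mono power_mono powr_mono2) (auto intro!: mult_pos_pos zero_less_power)
      also have "\<dots> = 2 ^ n * (2 powr (- (2 * s))) ^ j / (2 ^ Suc j) ^ DIM('a)"
        unfolding pw powr_minus by (simp add: n_def power_mult_distrib field_simps)
      finally show ?thesis using j by blast
    qed
  qed (use s geo[of "2 * s"] in auto)
  have small: "integrable lborel (\<lambda>y::'a. ?k y * indicator {y. norm y < 1} y)"
  \<comment> \<open>The norm may equal 2^-j, so the radius is doubled to obtain a strict inequality.
    It is then 4 times the inner radius 2^-(j+1), whence \<open>4 ^ n\<close>.\<close>
  proof (rule integrable_dyadic_bound[where r = "\<lambda>j. 2 / 2 ^ j" and a = "\<lambda>j. 4 ^ n * (2 powr (- (2 - 2 * s))) ^ j"])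
    fix y :: 'a
    assume "?k y * indicator {y. norm y < 1} y \<noteq> 0"
    then have y: "0 < norm y" "norm y < 1" by (auto simp: indicator_def split: if_splits)
    show "\<exists>j. norm y < 2 / 2 ^ j \<and> ?k y * indicator {y. norm y < 1} y \<le> 4 ^ n * (2 powr (- (2 - 2 * s))) ^ j / (2 / 2 ^ j) ^ DIM('a)"
    proof -
      obtain j where j: "2 ^ j \<le> 1 / norm y" "1 / norm y < 2 ^ Suc j"
        using dyadic_interval_exists[of "1 / norm y"] y by auto
      have jl: "norm y \<le> 1 / 2 ^ j" "1 / norm y \<le> 2 ^ Suc j" using j y by (auto simp: field_simps)
      have "norm y ^ 2 = norm y powr (2 - 2 * s) * norm y powr (2 * s)"
        using y by (simp add: powr_add[symmetric])
      moreover have "min 1 ((norm y)\<^sup>2) = (norm y)\<^sup>2" using y by (simp add: power_le_one)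
      ultimately have "?k y * indicator {y. norm y < 1} y = norm y powr (2 - 2 * s) * (1 / norm y) ^ n"
        using y by (simp add: n_def powr_add powr_realpow power_one_over field_simps del: min_def)
      also have "\<dots> \<le> (1 / 2 ^ j) powr (2 - 2 * s) * (2 ^ Suc j) ^ n"
        using jl s y by (intro mult_mono power_mono powr_mono2) auto
      also have "\<dots> = 4 ^ n * (2 powr (- (2 - 2 * s))) ^ j / (2 / 2 ^ j) ^ DIM('a)"
      proof -
        have "(1 / 2 ^ j) powr (2 - 2 * s) = (2 powr (- (2 - 2 * s))) ^ j"
          unfolding powr_minus power_inverse pw[symmetric] by (simp add: powr_divide inverse_eq_divide)
        moreover have "(2 ^ Suc j) ^ n = (4 ^ n / (2 / 2 ^ j) ^ n :: real)"
        proof -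
          have "(2 ^ Suc j) ^ n * (2 / 2 ^ j) ^ n = (4 ^ n :: real)"
            unfolding power_mult_distrib[symmetric] by simp
          then show ?thesis by (simp only: eq_divide_eq) simp
        qed
        ultimately show ?thesis by (simp add: n_def)
      qed
      finally have "?k y * indicator {y. norm y < 1} y \<le> 4 ^ n * (2 powr (- (2 - 2 * s))) ^ j / (2 / 2 ^ j) ^ DIM('a)" .
      moreover have "norm y < 2 / 2 ^ j"
        using jl(1) by (rule le_less_trans) (simp add: divide_strict_right_mono)
      ultimately show ?thesis by blast
    qed
  qed (use s geo[of "2 - 2 * s"] in auto)
  have "?k = (\<lambda>y. ?k y * indicator {y. norm y \<ge> 1} y + ?k y * indicator {y. norm y < 1} y)"
    by (auto simp: fun_eq_iff indicator_def)
  then show ?thesis using Bochner_Integration.integrable_add[OF big small] by simp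
qed

text \<open>From 2 - 2 cos z = 4 sin^2 (z/2) come the bounds z^2, useful for small y together with
  Cauchy-Schwarz, and 4, useful for large y.\<close>

lemma cos_second_difference_le:
  fixes \<xi> y :: "'a::euclidean_space"
  shows "2 - 2 * cos (\<xi> \<bullet> y) \<le> 4 * (1 + (norm \<xi>)\<^sup>2) * min 1 ((norm y)\<^sup>2)"
proof -
  have z: "2 - 2 * cos z \<le> z\<^sup>2" for z :: real
  proof -
    have "cos z = 1 - 2 * (sin (z / 2))\<^sup>2" using cos_double_sin[of "z / 2"] by simp
    moreover have "(sin (z / 2))\<^sup>2 \<le> (z / 2)\<^sup>2"
      using abs_sin_x_le_abs_x[of "z / 2"] abs_le_square_iff by blast
    ultimately show ?thesis by (simp add: power_divide)
  qed
  show ?thesis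
  proof (cases "norm y \<le> 1")
    case True
    have "(\<xi> \<bullet> y)\<^sup>2 \<le> (norm \<xi> * norm y)\<^sup>2"
      using Cauchy_Schwarz_ineq2[of \<xi> y] by (intro abs_le_square_iff[THEN iffD1]) (simp add: abs_mult)
    then have "2 - 2 * cos (\<xi> \<bullet> y) \<le> (norm \<xi>)\<^sup>2 * (norm y)\<^sup>2"
      using z[of "\<xi> \<bullet> y"] by (simp add: power_mult_distrib)
    also have "\<dots> \<le> (4 * (1 + (norm \<xi>)\<^sup>2)) * (norm y)\<^sup>2" by (intro mult_right_mono) auto
    also have "(norm y)\<^sup>2 = min 1 ((norm y)\<^sup>2)" using True by (simp add: power_le_one)
    finally show ?thesis .
  next
    case False
    then have m: "min 1 ((norm y)\<^sup>2) = 1" by (simp add: min_def one_le_power)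
    have "2 - 2 * cos (\<xi> \<bullet> y) \<le> 4" using cos_ge_minus_one[of "\<xi> \<bullet> y"] by linarith
    also have "4 \<le> 4 * (1 + (norm \<xi>)\<^sup>2)" by simp
    finally show ?thesis by (simp only: m mult_1_right)
  qed
qed

lemma integrable_bounded_by_levy_kernel:
  fixes f :: "'a::euclidean_space \<Rightarrow> real"
  assumes s: "0 < s" "s < 1" and [measurable]: "f \<in> borel_measurable borel"
    and f: "\<And>y. \<bar>f y\<bar> \<le> C * min 1 ((norm y)\<^sup>2)"
  shows "integrable lborel (\<lambda>y. f y / norm y powr (real DIM('a) + 2 * s))"
proof (rule Bochner_Integration.integrable_bound[OF integrable_mult_right[OF integrable_levy_kernel[OF s], of C]])
  show "AE y::'a in lborel. norm (f y / norm y powr (real DIM('a) + 2 * s))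
      \<le> norm (C * (min 1 ((norm y)\<^sup>2) / norm y powr (real DIM('a) + 2 * s)))"
  proof (rule AE_I2)
    fix y :: 'a
    have "\<bar>f y\<bar> \<le> \<bar>C * min 1 ((norm y)\<^sup>2)\<bar>" using f[of y] by linarith
    then show "norm (f y / norm y powr (real DIM('a) + 2 * s))
      \<le> norm (C * (min 1 ((norm y)\<^sup>2) / norm y powr (real DIM('a) + 2 * s)))"
      by (simp add: abs_divide divide_right_mono)
  qed
qed measurable

text \<open>If the integral vanished, the function would be zero almost everywhere and the nonempty
  open set \<open>U\<close> would be negligible.\<close>

lemma integral_pos_of_pos_on_open:
  fixes f :: "'a::euclidean_space \<Rightarrow> real"
  assumes int: "integrable lborel f" and f: "\<And>y. f y \<ge> 0"
    and U: "open U" "U \<noteq> {}" "\<And>y. y \<in> U \<Longrightarrow> f y > 0"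
  shows "integral\<^sup>L lborel f > 0"
proof (rule ccontr)
  assume "\<not> ?thesis"
  then have "integral\<^sup>L lborel f = 0" using integral_nonneg_AE[of f lborel] f by (simp add: order.antisym)
  then have "AE y in lborel. f y = 0" using integral_nonneg_eq_0_iff_AE[OF int] f by auto
  then have "AE y in lborel. y \<notin> U"
    by eventually_elim (use U(3) in force)
  then have "U \<in> null_sets lborel" using U(1) AE_iff_null_sets[of U lborel] by auto
  then have "negligible U" by (simp add: negligible_iff_null_sets null_sets_completionI)
  then show False using open_not_negligible U by blast
qed

text \<open>The factor by which the fractional Laplacian multiplies cos (\<xi> \<bullet> x), that
  is, the Fourier symbol in integral form. The argument rests on its nonnegativity and its at most
  quadratic growth.\<close>

definition frac_symbol :: "real \<Rightarrow> 'a::euclidean_space \<Rightarrow> real" where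
  "frac_symbol s \<xi> = frac_lap_const TYPE('a) s *
     (\<integral>y. (2 - 2 * cos (\<xi> \<bullet> y)) / norm y powr (real DIM('a) + 2 * s) \<partial>lborel)"

lemma integrable_frac_symbol:
  fixes \<xi> :: "'a::euclidean_space"
  assumes s: "0 < s" "s < 1"
  shows "integrable lborel (\<lambda>y. (2 - 2 * cos (\<xi> \<bullet> y)) / norm y powr (real DIM('a) + 2 * s))"
proof (rule integrable_bounded_by_levy_kernel[OF s])
  show "\<bar>2 - 2 * cos (\<xi> \<bullet> y)\<bar> \<le> 4 * (1 + (norm \<xi>)\<^sup>2) * min 1 ((norm y)\<^sup>2)" for y
    using cos_second_difference_le[of \<xi> y] by simp
qed measurable

lemma frac_lap_const_pos:
  assumes s: "0 < s" "s < 1"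
  shows "frac_lap_const TYPE('a::euclidean_space) s > 0"
proof -
  define e where "e = (SOME e::'a. norm e = 1)"
  have "\<exists>e::'a. norm e = 1" using norm_Basis nonempty_Basis by blast
  then have e: "norm e = 1" unfolding e_def by (rule someI_ex)
  have "integral\<^sup>L lborel (\<lambda>y. (2 - 2 * cos (e \<bullet> y)) / norm y powr (real DIM('a) + 2 * s)) > 0"
  proof (rule integral_pos_of_pos_on_open[OF integrable_frac_symbol[OF s]])
    \<comment> \<open>On this ball the inner product with \<open>e\<close> stays in (0, 2), inside
      (0, pi), so its cosine is strictly below 1.\<close>
    show "open (ball e 1)" "ball e 1 \<noteq> {}" by auto
    fix y assume y: "y \<in> ball e 1"
    have "e \<bullet> e = 1" using e by (simp add: norm_eq_1)
    have "\<bar>e \<bullet> (y - e)\<bar> < 1"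
      using Cauchy_Schwarz_ineq2[of e "y - e"] y e by (simp add: dist_norm norm_minus_commute)
    then have "0 < e \<bullet> y" "e \<bullet> y < 2" using \<open>e \<bullet> e = 1\<close> by (auto simp: inner_diff_right)
    then have "cos (e \<bullet> y) < 1"
      using cos_monotone_0_pi[of 0 "e \<bullet> y"] pi_gt3 by simp
    moreover have "y \<noteq> 0" using y e by auto
    ultimately show "0 < (2 - 2 * cos (e \<bullet> y)) / norm y powr (real DIM('a) + 2 * s)" by simp
  qed simp
  then show ?thesis by (simp add: frac_lap_const_def e_def)
qed

lemma frac_symbol_nonneg:
  assumes s: "0 < s" "s < 1"
  shows "frac_symbol s \<xi> \<ge> 0"
  unfolding frac_symbol_def using frac_lap_const_pos[OF s, where 'a='a]
  by (intro mult_nonneg_nonneg integral_nonneg_AE) (auto intro!: AE_I2)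

text \<open>Integrates the bound on 2 - 2 cos against the Levy kernel. Quadratic growth means that
  the weight (k+1)^4 on the coefficients dominates even the square of the symbol.\<close>

lemma frac_symbol_le:
  assumes s: "0 < s" "s < 1"
  obtains C where "C \<ge> 0" "\<And>\<xi>::'a::euclidean_space. frac_symbol s \<xi> \<le> C * (1 + (norm \<xi>)\<^sup>2)"
proof -
  define c where "c = frac_lap_const TYPE('a) s"
  define J where "J = integral\<^sup>L lborel (\<lambda>y::'a. min 1 ((norm y)\<^sup>2) / norm y powr (real DIM('a) + 2 * s))"
  have c: "c > 0" unfolding c_def by (rule frac_lap_const_pos[OF s])
  have J: "J \<ge> 0" unfolding J_def by (intro integral_nonneg_AE AE_I2) auto
  have "frac_symbol s \<xi> \<le> c * 4 * J * (1 + (norm \<xi>)\<^sup>2)" for \<xi> :: 'a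
  proof -
    have "(\<integral>y. (2 - 2 * cos (\<xi> \<bullet> y)) / norm y powr (real DIM('a) + 2 * s) \<partial>lborel)
      \<le> integral\<^sup>L lborel (\<lambda>y::'a. 4 * (1 + (norm \<xi>)\<^sup>2) * (min 1 ((norm y)\<^sup>2) / norm y powr (real DIM('a) + 2 * s)))"
    proof (intro integral_mono integrable_frac_symbol[OF s] integrable_mult_right integrable_levy_kernel[OF s])
      show "(2 - 2 * cos (\<xi> \<bullet> y)) / norm y powr (real DIM('a) + 2 * s)
        \<le> 4 * (1 + (norm \<xi>)\<^sup>2) * (min 1 ((norm y)\<^sup>2) / norm y powr (real DIM('a) + 2 * s))" for y
        using divide_right_mono[OF cos_second_difference_le[of \<xi> y], of "norm y powr (real DIM('a) + 2 * s)"] by simp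
    qed
    also have "\<dots> = 4 * (1 + (norm \<xi>)\<^sup>2) * J"
      unfolding J_def by (rule integral_mult_right_zero)
    finally show ?thesis
      using c by (simp add: frac_symbol_def c_def[symmetric] mult_left_mono mult_ac)
  qed
  then show thesis using that[of "c * 4 * J"] c J by auto
qed

section \<open>Test functions\<close>

lemma frechet_derivative_eq_0_outside_support:
  fixes f :: "'b::euclidean_space \<Rightarrow> real"
  assumes "x \<notin> closure {x. f x \<noteq> 0}"
  shows "(f has_derivative (\<lambda>_. 0)) (at x)" and "frechet_derivative f (at x) h = 0"
proof -
  show "(f has_derivative (\<lambda>_. 0)) (at x)"
  proof (rule has_derivative_transform_within_open[of "\<lambda>_. 0" _ _ _ "- closure {x. f x \<noteq> 0}"])
    show "0 = f y" if "y \<in> - closure {x. f x \<noteq> 0}" for y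
      using that closure_subset[of "{x. f x \<noteq> 0}"] by fastforce
  qed (use assms in auto)
  then show "frechet_derivative f (at x) h = 0"
    by (simp add: frechet_derivative_at[symmetric])
qed

text \<open>The partial derivatives are continuous and vanish off a compact set, hence are bounded,
  and the mean value inequality applies on the whole space.\<close>

lemma Ck_1_imp_Lipschitz:
  fixes f :: "'b::euclidean_space \<Rightarrow> real"
  assumes f: "Ck 1 f" and K: "compact K" "closure {x. f x \<noteq> 0} \<subseteq> K"
  obtains L where "L \<ge> 0" "\<And>x y. \<bar>f x - f y\<bar> \<le> L * norm (x - y)"
proof -
  have d: "f differentiable (at x)" for x using f by simp
  have "\<exists>B. \<forall>x. \<bar>frechet_derivative f (at x) j\<bar> \<le> B" for j
  proof -
    have "continuous_on K (\<lambda>x. frechet_derivative f (at x) j)"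
      using f by (auto intro: continuous_on_subset)
    then have "bounded ((\<lambda>x. frechet_derivative f (at x) j) ` K)"
      using K(1) compact_continuous_image compact_imp_bounded by blast
    then obtain B where B: "\<And>x. x \<in> K \<Longrightarrow> \<bar>frechet_derivative f (at x) j\<bar> \<le> B"
      by (auto simp: bounded_iff)
    \<comment> \<open>If \<open>K\<close> is empty, \<open>B\<close> is unconstrained and may be
      negative.\<close>
    have "\<bar>frechet_derivative f (at x) j\<bar> \<le> max B 0" for x
      using B[of x] frechet_derivative_eq_0_outside_support(2)[of x f j] K(2) by (cases "x \<in> K") force+
    then show ?thesis by blast
  qed
  then obtain B where B: "\<And>j x. \<bar>frechet_derivative f (at x) j\<bar> \<le> B j" by metis
  define L where "L = (\<Sum>j\<in>Basis. B j)"
  have B0: "B j \<ge> 0" for j using B[of 0 j] by linarith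
  have fd: "(f has_derivative frechet_derivative f (at x)) (at x)" for x
    using d frechet_derivative_works by blast
  have "norm (frechet_derivative f (at x) h) \<le> L * norm h" for x h
  proof -
    interpret bounded_linear "frechet_derivative f (at x)" using fd by (rule has_derivative_bounded_linear)
    have "frechet_derivative f (at x) h = (\<Sum>j\<in>Basis. (h \<bullet> j) * frechet_derivative f (at x) j)"
      by (subst euclidean_representation[of h, symmetric]) (simp only: sum scaleR real_scaleR_def)
    also have "norm \<dots> \<le> (\<Sum>j\<in>Basis. norm h * B j)"
      by (rule order_trans[OF norm_sum], rule sum_mono)
        (auto simp: abs_mult intro!: mult_mono B Basis_le_norm)
    finally show ?thesis by (simp add: L_def sum_distrib_left sum_distrib_right mult.commute)
  qed
  then have "norm (f x - f y) \<le> L * norm (x - y)" for x y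
    by (intro differentiable_bound[of UNIV f "\<lambda>x. frechet_derivative f (at x)"])
      (auto intro: onorm_le has_derivative_at_withinI fd)
  then show thesis using that[of L] B0 by (auto simp: L_def intro: sum_nonneg)
qed

text \<open>For small \<open>h\<close> the mean value theorem turns the second difference into a
  difference of first derivatives, which are Lipschitz; for large \<open>h\<close> the sup bound
  suffices. The resulting factor is the numerator of the Levy kernel.\<close>

lemma Ck_2_second_difference_bound:
  fixes f :: "'b::euclidean_space \<Rightarrow> real"
  assumes f: "Ck 2 f" and K: "compact K" "closure {x. f x \<noteq> 0} \<subseteq> K"
  obtains C where "C \<ge> 0" "\<And>z h. \<bar>f (z + h) + f (z - h) - 2 * f z\<bar> \<le> C * min 1 ((norm h)\<^sup>2)"
proof -
  have f2: "Ck (Suc 1) f" using f by (simp add: numeral_2_eq_2)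
  have d: "f differentiable (at x)" for x using f2 by simp
  have fd: "(f has_derivative frechet_derivative f (at x)) (at x)" for x
    using d frechet_derivative_works by blast
  have "\<exists>L. L \<ge> 0 \<and> (\<forall>x y. \<bar>frechet_derivative f (at x) j - frechet_derivative f (at y) j\<bar> \<le> L * norm (x - y))" for j
  proof -
    have "Ck 1 (\<lambda>x. frechet_derivative f (at x) j)" using f2 unfolding Ck.simps(2) by blast
    moreover have "closure {x. frechet_derivative f (at x) j \<noteq> 0} \<subseteq> K"
    proof (rule order_trans[OF _ K(2)], rule closure_minimal)
      show "{x. frechet_derivative f (at x) j \<noteq> 0} \<subseteq> closure {x. f x \<noteq> 0}"
        using frechet_derivative_eq_0_outside_support(2)[of _ f j] by auto
    qed auto
    ultimately show ?thesis using Ck_1_imp_Lipschitz[OF _ K(1)] by metis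
  qed
  then obtain L where L0: "\<And>j. L j \<ge> 0"
    and L: "\<And>j x y. \<bar>frechet_derivative f (at x) j - frechet_derivative f (at y) j\<bar> \<le> L j * norm (x - y)"
    by metis
  \<comment> \<open>The 2 accounts for the distance between the two points z + c h and z - c h with
    0 < c < 1 at which the first derivatives are compared.\<close>
  define M where "M = 2 * (\<Sum>j\<in>Basis. L j)"
  have M: "M \<ge> 0" unfolding M_def by (intro mult_nonneg_nonneg sum_nonneg L0) auto
  have quad: "\<bar>f (z + h) + f (z - h) - 2 * f z\<bar> \<le> M * (norm h)\<^sup>2" for z h
  proof -
    define \<psi> where "\<psi> \<tau> = f (z + \<tau> *\<^sub>R h) + f (z - \<tau> *\<^sub>R h)" for \<tau> :: real
    define \<psi>' where "\<psi>' \<tau> = frechet_derivative f (at (z + \<tau> *\<^sub>R h)) h - frechet_derivative f (at (z - \<tau> *\<^sub>R h)) h" for \<tau> :: real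
    have lin: "linear (frechet_derivative f (at x))" for x
      using fd has_derivative_linear by blast
    have "(\<psi> has_real_derivative \<psi>' \<tau>) (at \<tau>)" for \<tau>
    proof -
      have "((\<lambda>\<tau>. f (z + \<tau> *\<^sub>R h)) has_derivative (\<lambda>r. frechet_derivative f (at (z + \<tau> *\<^sub>R h)) (r *\<^sub>R h))) (at \<tau>)"
        by (rule has_derivative_compose[OF _ fd]) (auto intro!: derivative_eq_intros)
      moreover have "((\<lambda>\<tau>. f (z - \<tau> *\<^sub>R h)) has_derivative (\<lambda>r. frechet_derivative f (at (z - \<tau> *\<^sub>R h)) (- (r *\<^sub>R h)))) (at \<tau>)"
        by (rule has_derivative_compose[OF _ fd]) (auto intro!: derivative_eq_intros)
      ultimately have "(\<psi> has_derivative (\<lambda>r. frechet_derivative f (at (z + \<tau> *\<^sub>R h)) (r *\<^sub>R h) + frechet_derivative f (at (z - \<tau> *\<^sub>R h)) (- (r *\<^sub>R h)))) (at \<tau>)"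
        unfolding \<psi>_def by (rule has_derivative_add)
      moreover have "(\<lambda>r. frechet_derivative f (at (z + \<tau> *\<^sub>R h)) (r *\<^sub>R h) + frechet_derivative f (at (z - \<tau> *\<^sub>R h)) (- (r *\<^sub>R h))) = (*) (\<psi>' \<tau>)"
        using lin by (auto simp: fun_eq_iff \<psi>'_def linear_cmul linear_neg algebra_simps)
      ultimately show ?thesis by (simp add: has_field_derivative_def)
    qed
    then obtain c where c: "0 < c" "c < 1" "\<psi> 1 - \<psi> 0 = \<psi>' c"
      using MVT2[of 0 1 \<psi> \<psi>'] by auto
    have "\<psi>' c = (\<Sum>j\<in>Basis. (h \<bullet> j) * (frechet_derivative f (at (z + c *\<^sub>R h)) j - frechet_derivative f (at (z - c *\<^sub>R h)) j))"
    proof -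
      have "frechet_derivative f (at x) h = (\<Sum>j\<in>Basis. (h \<bullet> j) * frechet_derivative f (at x) j)" for x
        by (subst euclidean_representation[of h, symmetric]) (simp only: linear_sum[OF lin] linear_cmul[OF lin] real_scaleR_def)
      then show ?thesis by (simp add: \<psi>'_def right_diff_distrib sum_subtractf)
    qed
    also have "\<bar>\<dots>\<bar> \<le> (\<Sum>j\<in>Basis. norm h * (L j * (2 * norm h)))"
    proof (rule order_trans[OF sum_abs], rule sum_mono)
      fix j :: 'b assume j: "j \<in> Basis"
      have "\<bar>frechet_derivative f (at (z + c *\<^sub>R h)) j - frechet_derivative f (at (z - c *\<^sub>R h)) j\<bar> \<le> L j * norm ((2 * c) *\<^sub>R h)"
        using L[of "z + c *\<^sub>R h" j "z - c *\<^sub>R h"] by (simp add: scaleR_2[symmetric] flip: scaleR_scaleR)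
      also have "\<dots> \<le> L j * (2 * norm h)" using c L0[of j] by (intro mult_left_mono) (auto intro: mult_left_le_one_le)
      finally show "\<bar>(h \<bullet> j) * (frechet_derivative f (at (z + c *\<^sub>R h)) j - frechet_derivative f (at (z - c *\<^sub>R h)) j)\<bar>
          \<le> norm h * (L j * (2 * norm h))"
        unfolding abs_mult using Basis_le_norm[OF j, of h] by (intro mult_mono) auto
    qed
    also have "\<dots> = M * (norm h)\<^sup>2"
      by (simp add: M_def sum_distrib_left sum_distrib_right power2_eq_square mult_ac)
    finally show ?thesis using c by (simp add: \<psi>_def)
  qed
  have "continuous_on K f"
    using d by (intro differentiable_imp_continuous_on) (auto simp: differentiable_on_def intro: differentiable_at_withinI)
  then have "bounded (f ` K)" using K(1) compact_continuous_image compact_imp_bounded by blast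
  then obtain B where B: "\<And>x. x \<in> K \<Longrightarrow> \<bar>f x\<bar> \<le> B" by (auto simp: bounded_iff)
  define B' where "B' = max B 0"
  have B': "\<bar>f x\<bar> \<le> B'" for x
  proof (cases "x \<in> K")
    case False
    then have "f x = 0" using K(2) closure_subset[of "{x. f x \<noteq> 0}"] by blast
    then show ?thesis by (simp add: B'_def)
  qed (use B[of x] in \<open>auto simp: B'_def\<close>)
  have "\<bar>f (z + h) + f (z - h) - 2 * f z\<bar> \<le> (M + 4 * B') * min 1 ((norm h)\<^sup>2)" for z h
  proof (cases "norm h \<le> 1")
    case True
    then have "min 1 ((norm h)\<^sup>2) = (norm h)\<^sup>2" by (simp add: power_le_one)
    moreover have "M * (norm h)\<^sup>2 \<le> (M + 4 * B') * (norm h)\<^sup>2"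
      by (intro mult_right_mono) (auto simp: B'_def)
    ultimately show ?thesis using quad[of z h] by simp
  next
    case False
    then have "min 1 ((norm h)\<^sup>2) = 1" by (simp add: one_le_power)
    then show ?thesis using B'[of "z + h"] B'[of "z - h"] B'[of z] M by auto
  qed
  then show thesis using that[of "M + 4 * B'"] M by (auto simp: B'_def)
qed

text \<open>Links the one-variable \<open>deriv\<close> in the weak formulation with the Frechet
  derivative through which \<open>Ck\<close> expresses smoothness.\<close>

lemma deriv_fst_eq_frechet_derivative:
  fixes \<eta> :: "real \<times> 'a::euclidean_space \<Rightarrow> real"
  assumes "\<eta> differentiable (at (t, x))"
  shows "((\<lambda>\<tau>. \<eta> (\<tau>, x)) has_real_derivative frechet_derivative \<eta> (at (t, x)) (1, 0)) (at t)"
proof -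
  have fd: "(\<eta> has_derivative frechet_derivative \<eta> (at (t, x))) (at (t, x))"
    using assms frechet_derivative_works by blast
  have "((\<lambda>\<tau>. \<eta> (\<tau>, x)) has_derivative (\<lambda>r. frechet_derivative \<eta> (at (t, x)) (r, 0))) (at t)"
    by (rule has_derivative_compose[of "\<lambda>\<tau>. (\<tau>, x)", OF _ fd]) (auto intro!: derivative_eq_intros)
  moreover have "frechet_derivative \<eta> (at (t, x)) (r, 0) = frechet_derivative \<eta> (at (t, x)) (1, 0) * r" for r
    using linear_cmul[OF has_derivative_linear[OF fd], of r "(1, 0)"] by (simp add: mult.commute)
  then have "(\<lambda>r. frechet_derivative \<eta> (at (t, x)) (r, 0)) = (*) (frechet_derivative \<eta> (at (t, x)) (1, 0))"
    by blast
  ultimately show ?thesis unfolding has_field_derivative_def by (simp only:)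
qed

lemma lborel_translation:
  fixes f :: "'b::euclidean_space \<Rightarrow> real"
  assumes f: "integrable lborel f"
  shows "integrable lborel (\<lambda>z. f (z + a))" and "(\<integral>z. f (z + a) \<partial>lborel) = (\<integral>z. f z \<partial>lborel)"
proof -
  have [measurable]: "f \<in> borel_measurable borel" using f by auto
  have "integrable (distr lborel borel ((+) a)) f" using f by (simp add: lborel_distr_plus)
  then show "integrable lborel (\<lambda>z. f (z + a))"
    by (subst (asm) integrable_distr_eq) (auto simp: add.commute)
  have "(\<integral>z. f z \<partial>lborel) = (\<integral>z. f z \<partial>(distr lborel borel ((+) a)))" by (simp add: lborel_distr_plus)
  also have "\<dots> = (\<integral>z. f (z + a) \<partial>lborel)"
    by (subst integral_distr) (auto simp: add.commute)
  finally show "(\<integral>z. f (z + a) \<partial>lborel) = (\<integral>z. f z \<partial>lborel)" by simp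
qed

lemma integrable_compact_support:
  fixes f :: "'b::euclidean_space \<Rightarrow> real"
  assumes f: "continuous_on UNIV f" and K: "compact K" "\<And>x. x \<notin> K \<Longrightarrow> f x = 0"
  shows "integrable lborel f"
proof -
  have "set_integrable lborel K f"
    unfolding set_integrable_def
    by (rule borel_integrable_compact[OF K(1)]) (rule continuous_on_subset[OF f], simp)
  moreover have "(\<lambda>x. indicator K x *\<^sub>R f x) = f" using K(2) by (auto simp: fun_eq_iff indicator_def)
  ultimately show ?thesis by (simp add: set_integrable_def)
qed

lemma integrable_mult_bounded:
  fixes u f :: "'b \<Rightarrow> real"
  assumes f: "integrable M f" and u: "u \<in> borel_measurable M" and B: "\<And>x. \<bar>u x\<bar> \<le> B"
  shows "integrable M (\<lambda>x. u x * f x)"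
proof (rule Bochner_Integration.integrable_bound[OF integrable_mult_right[OF f, of B]])
  show "AE x in M. norm (u x * f x) \<le> norm (B * f x)"
  proof (rule AE_I2)
    fix x
    have "\<bar>u x\<bar> \<le> \<bar>B\<bar>" using B[of x] by linarith
    then show "norm (u x * f x) \<le> norm (B * f x)" by (simp add: abs_mult mult_right_mono)
  qed
qed (use f u in auto)

section \<open>Moving the fractional Laplacian from a test function to a plane wave\<close>

context
  fixes s :: real and \<eta> :: "real \<times> 'a::euclidean_space \<Rightarrow> real" and K C
  assumes s: "0 < s" "s < 1"
    and \<eta>: "continuous_on UNIV \<eta>"
    and K: "compact K" "\<And>z. z \<notin> K \<Longrightarrow> \<eta> z = 0"
    and C: "\<And>z h. \<bar>\<eta> (z + h) + \<eta> (z - h) - 2 * \<eta> z\<bar> \<le> C * min 1 ((norm h)\<^sup>2)"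
begin

private definition "\<Delta> z y = \<eta> (z + (0, y)) + \<eta> (z - (0, y)) - 2 * \<eta> z"
private definition "\<kappa> y = norm y powr (real DIM('a) + 2 * s)" for y :: 'a

private lemma \<eta>_meas [measurable]: "\<eta> \<in> borel_measurable borel"
  using \<eta> by (rule borel_measurable_continuous_onI)

private lemma int_\<eta>: "integrable lborel \<eta>"
  by (rule integrable_compact_support[OF \<eta> K])

private lemma \<Delta>_meas: "(\<lambda>(y, z). \<Delta> z y) \<in> borel_measurable (borel \<Otimes>\<^sub>M borel)"
  unfolding borel_prod \<Delta>_def case_prod_beta
  by (intro borel_measurable_continuous_onI continuous_intros continuous_on_compose2[OF \<eta>]) auto

private lemma \<kappa>_meas [measurable]: "\<kappa> \<in> borel_measurable borel"
  unfolding \<kappa>_def[abs_def] by measurable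

private lemma C_nonneg: "C \<ge> 0"
proof -
  obtain h :: "real \<times> 'a" where "h \<in> Basis" using nonempty_Basis by blast
  then show ?thesis using order_trans[OF abs_ge_zero C[of 0 h]] by simp
qed

text \<open>The uniform second-difference bound alone is not integrable in \<open>z\<close>. The
  three indicators record that \<open>\<Delta> z y\<close> vanishes unless \<open>z\<close> or one
  of its two translates meets \<open>K\<close>.\<close>

private lemma \<Delta>_bound:
  "\<bar>\<Delta> z y\<bar> \<le> C * min 1 ((norm y)\<^sup>2) * (indicator K z + indicator K (z + (0, y)) + indicator K (z + (0, - y)))"
proof (cases "z \<in> K \<or> z + (0, y) \<in> K \<or> z + (0, - y) \<in> K")
  case True
  then have "1 \<le> indicator K z + indicator K (z + (0, y)) + (indicator K (z + (0, - y)) :: real)"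
    by (auto simp: indicator_def)
  then have "C * min 1 ((norm y)\<^sup>2) * 1 \<le> C * min 1 ((norm y)\<^sup>2) * (indicator K z + indicator K (z + (0, y)) + indicator K (z + (0, - y)))"
    using C_nonneg by (intro mult_left_mono) auto
  then show ?thesis using C[of z "(0, y)"] by (simp add: \<Delta>_def norm_Pair)
next
  case False
  then have "\<Delta> z y = 0" using K(2) by (simp add: \<Delta>_def minus_prod_def plus_prod_def)
  then show ?thesis using C_nonneg by simp
qed

private lemma int_ind: "integrable lborel (\<lambda>z. indicator K z :: real)"
  using emeasure_bounded_finite[OF compact_imp_bounded[OF K(1)]] K(1)
  by (intro integrable_real_indicator) (auto intro: borel_compact)

private lemma int_\<Delta>: "integrable lborel (\<lambda>z. \<Delta> z y)"
  unfolding \<Delta>_def using lborel_translation(1)[OF int_\<eta>, of "(0, y)"] lborel_translation(1)[OF int_\<eta>, of "- (0, y)"] int_\<eta>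
  by (auto simp only: diff_conv_add_uminus intro!: Bochner_Integration.integrable_add Bochner_Integration.integrable_minus integrable_mult_right)

text \<open>The translates of \<open>K\<close> have the same measure as \<open>K\<close>, whence the
  factor 3. The L1 norm in \<open>z\<close> thus keeps the decay in \<open>y\<close> needed against
  the singular kernel.\<close>

private lemma norm_\<Delta>_integral: "(\<integral>z. \<bar>\<Delta> z y\<bar> \<partial>lborel) \<le> 3 * C * measure lborel K * min 1 ((norm y)\<^sup>2)"
proof -
  let ?g = "\<lambda>z. indicator K z + indicator K (z + (0, y)) + (indicator K (z + (0, - y)) :: real)"
  note tr = lborel_translation[OF int_ind]
  have "(\<integral>z. \<bar>\<Delta> z y\<bar> \<partial>lborel) \<le> (\<integral>z. C * min 1 ((norm y)\<^sup>2) * ?g z \<partial>lborel)"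
    by (intro integral_mono integrable_abs int_\<Delta> integrable_mult_right Bochner_Integration.integrable_add int_ind tr(1) \<Delta>_bound)
  also have "\<dots> = C * min 1 ((norm y)\<^sup>2) * (\<integral>z. ?g z \<partial>lborel)" by simp
  also have "(\<integral>z. ?g z \<partial>lborel) = 3 * measure lborel K"
    using int_ind tr by (simp add: Bochner_Integration.integral_add)
  finally show ?thesis by (simp add: mult_ac)
qed

text \<open>Joint integrability in \<open>y\<close> and \<open>z\<close> is what allows the singular
  integral and the space-time integral to be exchanged. Integrating over \<open>z\<close> first
  leaves a function of \<open>y\<close> dominated by the Levy kernel.\<close>

private lemma int_pair: "integrable (lborel \<Otimes>\<^sub>M lborel) (\<lambda>(y, z). \<Delta> z y / \<kappa> y)"
proof (rule lborel_pair.Fubini_integrable)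
  show [measurable]: "(\<lambda>(y, z). \<Delta> z y / \<kappa> y) \<in> borel_measurable (lborel \<Otimes>\<^sub>M lborel)"
  proof -
    have "(\<lambda>p. (\<lambda>(y, z). \<Delta> z y) p / \<kappa> (fst p)) \<in> borel_measurable (borel \<Otimes>\<^sub>M borel)"
      using \<Delta>_meas by measurable
    then show ?thesis by (simp add: case_prod_beta')
  qed
  have eq: "(\<integral>z. norm (\<Delta> z y / \<kappa> y) \<partial>lborel) = (\<integral>z. \<bar>\<Delta> z y\<bar> \<partial>lborel) / \<kappa> y" for y
    by (simp add: abs_divide \<kappa>_def)
  have "integrable lborel (\<lambda>y::'a. (\<integral>z. \<bar>\<Delta> z y\<bar> \<partial>lborel) / \<kappa> y)"
    unfolding \<kappa>_def
  proof (rule integrable_bounded_by_levy_kernel[OF s])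
    have "(\<lambda>(y, z). \<bar>\<Delta> z y\<bar>) \<in> borel_measurable (lborel \<Otimes>\<^sub>M lborel)"
      using \<Delta>_meas by (simp add: case_prod_beta') 
    from lborel.borel_measurable_lebesgue_integral[OF this]
    show "(\<lambda>y. \<integral>z. \<bar>\<Delta> z y\<bar> \<partial>lborel) \<in> borel_measurable borel" by simp
    show "\<bar>\<integral>z. \<bar>\<Delta> z y\<bar> \<partial>lborel\<bar> \<le> 3 * C * measure lborel K * min 1 ((norm y)\<^sup>2)" for y
      using norm_\<Delta>_integral[of y] by (subst abs_of_nonneg) (auto intro: integral_nonneg_AE)
  qed
  then show "integrable lborel (\<lambda>y. \<integral>z. norm (case (y, z) of (y, z) \<Rightarrow> \<Delta> z y / \<kappa> y) \<partial>lborel)"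
    by (simp only: prod.case eq)
  show "AE y in lborel. integrable lborel (\<lambda>z. case (y, z) of (y, z) \<Rightarrow> \<Delta> z y / \<kappa> y)"
    using int_\<Delta> by (intro AE_I2) simp
qed

private lemma frac_lap_eq:
  "frac_lap s (\<lambda>x. \<eta> (fst z, x)) (snd z) = - (frac_lap_const TYPE('a) s * (\<integral>y. \<Delta> z y / \<kappa> y \<partial>lborel))"
  by (cases z) (simp add: frac_lap_def \<Delta>_def \<kappa>_def)

lemma integrable_frac_lap: "integrable lborel (\<lambda>z. frac_lap s (\<lambda>x. \<eta> (fst z, x)) (snd z))"
  unfolding frac_lap_eq
  by (intro Bochner_Integration.integrable_minus integrable_mult_right lborel_pair.integrable_snd int_pair)

text \<open>Fubini and translation invariance shift the second difference from \<open>\<eta>\<close>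
  to \<open>u\<close>, where the hypothesis on \<open>u\<close> replaces it by multiplication with 2
  cos (\<xi> \<bullet> y) - 2. Thus \<open>u\<close>, merely bounded and measurable, acts as an
  eigenfunction in the weak sense.\<close>

lemma integral_mult_frac_lap:
  fixes u :: "real \<times> 'a \<Rightarrow> real"
  assumes u [measurable]: "u \<in> borel_measurable borel" and B: "\<And>z. \<bar>u z\<bar> \<le> B"
    and \<xi>: "\<And>z y. u (z + (0, y)) + u (z - (0, y)) = 2 * cos (\<xi> \<bullet> y) * u z"
  shows "(\<integral>z. u z * frac_lap s (\<lambda>x. \<eta> (fst z, x)) (snd z) \<partial>lborel) = frac_symbol s \<xi> * (\<integral>z. u z * \<eta> z \<partial>lborel)"
proof -
  define c where "c = frac_lap_const TYPE('a) s"
  have bdd: "integrable lborel (\<lambda>z. u (z + a) * \<eta> z)" for a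
    by (rule integrable_mult_bounded[OF int_\<eta> _ B]) measurable
  have inner: "(\<integral>z. u z * \<Delta> z y \<partial>lborel) = - ((2 - 2 * cos (\<xi> \<bullet> y)) * (\<integral>z. u z * \<eta> z \<partial>lborel))" for y
  proof -
    have sh: "integrable lborel (\<lambda>z. u z * \<eta> (z + a))" "(\<integral>z. u z * \<eta> (z + a) \<partial>lborel) = (\<integral>z. u (z - a) * \<eta> z \<partial>lborel)" for a
      using lborel_translation[OF bdd[of "- a"], of a] by simp_all
    have "(\<integral>z. u z * \<Delta> z y \<partial>lborel) = (\<integral>z. u z * \<eta> (z + (0, y)) + u z * \<eta> (z + - (0, y)) - 2 * (u z * \<eta> z) \<partial>lborel)"
      by (simp only: \<Delta>_def diff_conv_add_uminus distrib_left mult_minus_right mult.left_commute)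
    also have "\<dots> = (\<integral>z. u (z - (0, y)) * \<eta> z \<partial>lborel) + (\<integral>z. u (z + (0, y)) * \<eta> z \<partial>lborel) - 2 * (\<integral>z. u z * \<eta> z \<partial>lborel)"
      using sh(1)[of "(0, y)"] sh(1)[of "- (0, y)"] bdd[of 0]
      by (simp add: sh(2)[of "(0, y)"] sh(2)[of "- (0, y)"] del: uminus_Pair add_uminus_conv_diff)
    also have "\<dots> = (\<integral>z. (u (z + (0, y)) + u (z - (0, y))) * \<eta> z \<partial>lborel) - 2 * (\<integral>z. u z * \<eta> z \<partial>lborel)"
      using bdd[of "(0, y)"] bdd[of "- (0, y)"] by (simp add: distrib_right del: uminus_Pair)
    also have "\<dots> = - ((2 - 2 * cos (\<xi> \<bullet> y)) * (\<integral>z. u z * \<eta> z \<partial>lborel))"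
      by (simp only: \<xi> mult.assoc integral_mult_right_zero) (simp add: algebra_simps)
    finally show ?thesis .
  qed
  have pair: "integrable (lborel \<Otimes>\<^sub>M lborel) (\<lambda>(y, z). u z * (\<Delta> z y / \<kappa> y))"
    using integrable_mult_bounded[OF int_pair, of "\<lambda>p. u (snd p)" B] B by (simp add: case_prod_beta')
  have "(\<integral>z. u z * frac_lap s (\<lambda>x. \<eta> (fst z, x)) (snd z) \<partial>lborel) = - c * (\<integral>z. (\<integral>y. u z * (\<Delta> z y / \<kappa> y) \<partial>lborel) \<partial>lborel)"
  proof -
    have "u z * frac_lap s (\<lambda>x. \<eta> (fst z, x)) (snd z) = - c * (\<integral>y. u z * (\<Delta> z y / \<kappa> y) \<partial>lborel)" for z
      unfolding frac_lap_eq c_def[symmetric] integral_mult_right_zero by (simp add: mult_ac)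
    then show ?thesis by (simp only: integral_mult_right_zero)
  qed
  also have "\<dots> = - c * (\<integral>y. (\<integral>z. u z * (\<Delta> z y / \<kappa> y) \<partial>lborel) \<partial>lborel)"
    by (subst lborel_pair.Fubini_integral[OF pair]) simp
  also have "(\<lambda>y. \<integral>z. u z * (\<Delta> z y / \<kappa> y) \<partial>lborel) = (\<lambda>y. (\<integral>z. u z * \<Delta> z y \<partial>lborel) / \<kappa> y)"
    by simp
  also have "\<dots> = (\<lambda>y. - (\<integral>z. u z * \<eta> z \<partial>lborel) * ((2 - 2 * cos (\<xi> \<bullet> y)) / \<kappa> y))"
    unfolding inner by (simp add: mult.commute)
  also have "- c * integral\<^sup>L lborel \<dots> = frac_symbol s \<xi> * (\<integral>z. u z * \<eta> z \<partial>lborel)"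
    unfolding integral_mult_right_zero by (simp add: frac_symbol_def c_def \<kappa>_def)
  finally show ?thesis .
qed

end

section \<open>The relaxation equation\<close>

text \<open>Comparison principle: (y - K) exp (m t) has derivative m exp (m t) (\<phi> - K), which
  is nonpositive, so it cannot rise above its nonpositive initial value.\<close>

lemma relaxation_upper_bound:
  fixes y \<phi> :: "real \<Rightarrow> real"
  assumes m: "m \<ge> 0"
    and y: "\<And>t. t \<in> {a..b} \<Longrightarrow> (y has_real_derivative m * (\<phi> t - y t)) (at t within {a..b})"
    and \<phi>: "\<And>t. t \<in> {a..b} \<Longrightarrow> \<phi> t \<le> K"
    and a: "y a \<le> K" and t: "t \<in> {a..b}"
  shows "y t \<le> K"
proof -
  define z where "z t = (y t - K) * exp (m * t)" for t
  have "\<exists>D. (z has_real_derivative D) (at r within {a..b}) \<and> D \<le> 0" if r: "r \<in> {a..b}" for r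
  proof (intro exI conjI)
    show "(z has_real_derivative (m * (\<phi> r - y r)) * exp (m * r) + (y r - K) * (exp (m * r) * m)) (at r within {a..b})"
      unfolding z_def by (rule derivative_eq_intros y[OF r] refl | simp)+
    have "(m * (\<phi> r - y r)) * exp (m * r) + (y r - K) * (exp (m * r) * m) = m * exp (m * r) * (\<phi> r - K)"
      by (simp add: algebra_simps)
    also have "\<dots> \<le> 0" using m \<phi>[OF r] by (intro mult_nonneg_nonpos) auto
    finally show "(m * (\<phi> r - y r)) * exp (m * r) + (y r - K) * (exp (m * r) * m) \<le> 0" .
  qed
  note z = this
  have "z t \<le> z a"
  proof (rule DERIV_nonpos_imp_decreasing_open[of a t z])
    show "\<exists>D. (z has_real_derivative D) (at r) \<and> D \<le> 0" if "a < r" "r < t" for r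
      using z[of r] that t at_within_Icc_at[of a r b] by auto
    show "continuous_on {a..t} z"
    proof (rule continuous_on_subset[of "{a..b}"])
      show "continuous_on {a..b} z"
        using z DERIV_continuous unfolding continuous_on_eq_continuous_within by blast
    qed (use t in auto)
  qed (use t in auto)
  also have "z a \<le> 0" unfolding z_def using a by (intro mult_nonpos_nonneg) auto
  finally show ?thesis by (auto simp: z_def mult_le_0_iff)
qed

lemma relaxation_abs_bound:
  fixes y \<phi> :: "real \<Rightarrow> real"
  assumes m: "m \<ge> 0"
    and y: "\<And>t. t \<in> {a..b} \<Longrightarrow> (y has_real_derivative m * (\<phi> t - y t)) (at t within {a..b})"
    and \<phi>: "\<And>t. t \<in> {a..b} \<Longrightarrow> \<bar>\<phi> t\<bar> \<le> K"
    and a: "\<bar>y a\<bar> \<le> K" and t: "t \<in> {a..b}"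
  shows "\<bar>y t\<bar> \<le> K"
proof -
  have "y t \<le> K"
    by (rule relaxation_upper_bound[OF m y _ _ t]) (use \<phi> a in \<open>auto simp: abs_le_iff\<close>)
  moreover have "- y t \<le> K"
  proof (rule relaxation_upper_bound[OF m _ _ _ t, where \<phi> = "\<lambda>t. - \<phi> t"])
    show "((\<lambda>t. - y t) has_real_derivative m * (- \<phi> r - - y r)) (at r within {a..b})" if "r \<in> {a..b}" for r
      using DERIV_minus[OF y[OF that]] by (simp add: algebra_simps)
  qed (use \<phi> a in \<open>auto simp: abs_le_iff\<close>)
  ultimately show ?thesis by auto
qed

text \<open>The increment y(t+h) - y(t) solves the same equation with right-hand datum \<phi>(t+h) -
  \<phi>(t), so comparison bounds it by h^\<beta>. The constant does not depend on \<open>m\<close>,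
  which makes the estimate uniform over all frequencies.\<close>

lemma relaxation_holder:
  fixes y \<phi> :: "real \<Rightarrow> real"
  assumes m: "m \<ge> 0"
    and y: "\<And>t. t \<in> {a..b} \<Longrightarrow> (y has_real_derivative m * (\<phi> t - y t)) (at t within {a..b})"
    and \<phi>: "\<And>t r. t \<in> {a..b} \<Longrightarrow> r \<in> {a..b} \<Longrightarrow> \<bar>\<phi> t - \<phi> r\<bar> \<le> \<bar>t - r\<bar> powr \<beta>"
    and \<beta>: "\<beta> \<ge> 0"
    and a: "y a = 0" "\<phi> a = 0" and t: "t \<in> {a..b}" and r: "r \<in> {a..b}"
  shows "\<bar>y t - y r\<bar> \<le> \<bar>t - r\<bar> powr \<beta>"
proof -
  have *: "\<bar>y (r + h) - y r\<bar> \<le> h powr \<beta>" if h: "h \<ge> 0" and r: "r \<in> {a..b - h}" for h r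
  proof (rule relaxation_abs_bound[OF m _ _ _ r, where \<phi> = "\<lambda>t. \<phi> (t + h) - \<phi> t" and y = "\<lambda>t. y (t + h) - y t"])
    fix t assume t: "t \<in> {a..b - h}"
    have "((\<lambda>t. y (t + h)) has_real_derivative m * (\<phi> (t + h) - y (t + h))) (at t within {a..b - h})"
    proof -
      have "(y has_real_derivative m * (\<phi> (t + h) - y (t + h))) (at (t + h) within (\<lambda>t. t + h) ` {a..b - h})"
        by (rule DERIV_subset[OF y]) (use t h in auto)
      then show ?thesis
        using DERIV_image_chain[of y "m * (\<phi> (t + h) - y (t + h))" "\<lambda>t. t + h" t "{a..b - h}" 1]
          DERIV_add[OF DERIV_ident[of "at t within {a..b - h}"] DERIV_const[of h]]
        by (simp add: o_def)
    qed
    moreover have "(y has_real_derivative m * (\<phi> t - y t)) (at t within {a..b - h})"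
      by (rule DERIV_subset[OF y]) (use t h in auto)
    ultimately show "((\<lambda>t. y (t + h) - y t) has_real_derivative m * (\<phi> (t + h) - \<phi> t - (y (t + h) - y t))) (at t within {a..b - h})"
      by (rule DERIV_diff[THEN DERIV_cong]) (simp add: algebra_simps)
    show "\<bar>\<phi> (t + h) - \<phi> t\<bar> \<le> h powr \<beta>"
      using \<phi>[of "t + h" t] t h by auto
  next
    \<comment> \<open>The initial value of the increment needs a comparison of its own, on [a, a+h],
      where \<phi> is bounded by h^\<beta> because it vanishes at \<open>a\<close>.\<close>
    have "\<bar>y (a + h)\<bar> \<le> h powr \<beta>"
    proof (rule relaxation_abs_bound[OF m, of a "a + h" y \<phi>])
      show "(y has_real_derivative m * (\<phi> t - y t)) (at t within {a..a + h})" if "t \<in> {a..a + h}" for t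
        by (rule DERIV_subset[OF y]) (use r that in auto)
      show "\<bar>\<phi> t\<bar> \<le> h powr \<beta>" if "t \<in> {a..a + h}" for t
      proof -
        have "\<bar>\<phi> t\<bar> \<le> (t - a) powr \<beta>" using \<phi>[of t a] a(2) that r by auto
        also have "\<dots> \<le> h powr \<beta>" using that \<beta> by (intro powr_mono2) auto
        finally show ?thesis .
      qed
    qed (use a h in auto)
    then show "\<bar>y (a + h) - y a\<bar> \<le> h powr \<beta>" by (simp add: a)
  qed
  show ?thesis
  proof (cases "r \<le> t")
    case True
    then show ?thesis using *[of "t - r" r] t r by auto
  next
    case False
    then show ?thesis using *[of "r - t" t] t r by (auto simp: abs_minus_commute)
  qed
qed

text \<open>Variation of constants with integrating factor exp (m t).\<close>

lemma relaxation_solution_exists: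
  fixes \<phi> :: "real \<Rightarrow> real"
  assumes \<phi>: "continuous_on {a..b} \<phi>"
  obtains y where "y a = 0"
    "\<And>t. t \<in> {a..b} \<Longrightarrow> (y has_real_derivative m * (\<phi> t - y t)) (at t within {a..b})"
proof -
  define y where "y t = m * exp (- m * t) * integral {a..t} (\<lambda>\<tau>. exp (m * \<tau>) * \<phi> \<tau>)" for t
  have "(y has_real_derivative m * (\<phi> t - y t)) (at t within {a..b})" if t: "t \<in> {a..b}" for t
  proof -
    have "((\<lambda>t. integral {a..t} (\<lambda>\<tau>. exp (m * \<tau>) * \<phi> \<tau>)) has_real_derivative exp (m * t) * \<phi> t) (at t within {a..b})"
      by (rule integral_has_real_derivative[OF _ t]) (intro continuous_intros \<phi>)
    moreover have "((\<lambda>t. m * exp (- m * t)) has_real_derivative m * (exp (- m * t) * (- m))) (at t within {a..b})"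
      by (rule derivative_eq_intros refl | simp)+
    ultimately have D: "(y has_real_derivative m * (exp (- m * t) * (- m)) * integral {a..t} (\<lambda>\<tau>. exp (m * \<tau>) * \<phi> \<tau>)
         + exp (m * t) * \<phi> t * (m * exp (- m * t))) (at t within {a..b})"
      unfolding y_def using DERIV_mult by blast
    have 1: "exp (m * t) * \<phi> t * (m * exp (- m * t)) = m * \<phi> t"
      by (simp add: exp_minus field_simps)
    have 2: "m * (exp (- m * t) * (- m)) * integral {a..t} (\<lambda>\<tau>. exp (m * \<tau>) * \<phi> \<tau>) = - (m * y t)"
      by (simp add: y_def)
    show "(y has_real_derivative m * (\<phi> t - y t)) (at t within {a..b})"
      using D unfolding 1 2 by (rule DERIV_cong) (simp add: algebra_simps)
  qed
  then show thesis by (intro that[of y]) (simp_all add: y_def)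
qed

text \<open>Subadditivity of r^\<beta> for \<beta> <= 1: after dividing by the sum, both summands
  lie in [0,1], where r <= r^\<beta>.\<close>

lemma powr_diff_le:
  fixes x y :: real
  assumes "0 \<le> x" "0 \<le> y" "0 < \<beta>" "\<beta> \<le> 1"
  shows "\<bar>x powr \<beta> - y powr \<beta>\<bar> \<le> \<bar>x - y\<bar> powr \<beta>"
proof -
  have *: "(u + h) powr \<beta> \<le> u powr \<beta> + h powr \<beta>" if "u \<ge> 0" "h \<ge> 0" for u h :: real
  proof (cases "u + h = 0")
    case False
    define S where "S = u + h"
    have S: "S > 0" using that False by (simp add: S_def)
    have le: "r \<le> r powr \<beta>" if "0 \<le> r" "r \<le> 1" for r :: real
      using powr_mono'[of \<beta> 1 r] that assms by simp
    have "1 = u / S + h / S" using S by (simp add: S_def add_divide_distrib[symmetric])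
    also have "\<dots> \<le> (u / S) powr \<beta> + (h / S) powr \<beta>"
      using that S by (intro add_mono le) (auto simp: S_def)
    also have "\<dots> = (u powr \<beta> + h powr \<beta>) / S powr \<beta>"
      using that S by (simp add: powr_divide add_divide_distrib)
    finally show ?thesis using S by (simp add: field_simps S_def)
  qed (use that in simp)
  show ?thesis
    using *[of y "x - y"] *[of x "y - x"] powr_mono2[of \<beta> x y] powr_mono2[of \<beta> y x] assms
    by (cases "x \<le> y") auto
qed

section \<open>The solution\<close>

text \<open>Interpolates between the Lipschitz bound, used for d <= 1 where d <= d^\<alpha>, and the
  trivial bound 2. The constant is linear in the frequency bound \<open>c\<close>.\<close>

lemma abs_cos_diff_le_powr:
  fixes a d :: real
  assumes "d \<ge> 0" "1 \<le> c" "\<bar>x - y\<bar> \<le> c * d" "0 \<le> \<alpha>" "\<alpha> \<le> 1"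
  shows "\<bar>cos x - cos y\<bar> \<le> 2 * c * d powr \<alpha>"
proof (cases "d \<le> 1")
  case True
  have "\<bar>cos x - cos y\<bar> \<le> \<bar>x - y\<bar>"
    using abs_sin_x_le_abs_x[of "(y - x) / 2"] abs_sin_le_one[of "(x + y) / 2"]
      mult_mono[of "\<bar>sin ((x + y) / 2)\<bar>" 1 "\<bar>sin ((y - x) / 2)\<bar>" "\<bar>(y - x) / 2\<bar>"]
    by (simp add: cos_diff_cos abs_mult abs_minus_commute[of x])
  also have "\<dots> \<le> c * d" by fact
  also have "d \<le> d powr \<alpha>"
    using powr_mono'[of \<alpha> 1 d] True assms by simp
  also have "c * d powr \<alpha> \<le> 2 * c * d powr \<alpha>"
    using assms by (intro mult_right_mono) auto
  finally show ?thesis using assms by (simp add: mult_left_mono)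
next
  case False
  have "\<bar>cos x - cos y\<bar> \<le> 2"
    using cos_le_one[of x] cos_le_one[of y] cos_ge_minus_one[of x] cos_ge_minus_one[of y] by linarith
  also have "2 = 2 * 1 * (1::real)" by simp
  also have "2 * 1 * 1 \<le> 2 * c * d powr \<alpha>"
    using assms False by (intro mult_mono ge_one_powr_ge_zero) auto
  finally show ?thesis .
qed

text \<open>Dividing by h^\<beta> leaves A <= M h^\<epsilon>, whose right-hand side tends to 0 with
  h.\<close>

lemma powr_le_powr_imp_False:
  fixes A M \<epsilon> :: real
  assumes "A > 0" "M \<ge> 0" "\<epsilon> > 0" "h0 > 0"
    and le: "\<And>h. 0 < h \<Longrightarrow> h < h0 \<Longrightarrow> A * h powr \<beta> \<le> M * h powr (\<beta> + \<epsilon>)"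
  shows False
proof -
  \<comment> \<open>The second entry forces M h^\<epsilon> below A; the 1 added to \<open>M\<close>
    covers M = 0, and halving \<open>h0\<close> gives the strict inequality.\<close>
  define h where "h = min (h0 / 2) ((A / (2 * (M + 1))) powr (1 / \<epsilon>))"
  have h: "0 < h" "h < h0" using assms by (auto simp: h_def min_def)
  have "h powr \<epsilon> \<le> ((A / (2 * (M + 1))) powr (1 / \<epsilon>)) powr \<epsilon>"
    using h assms by (intro powr_mono2) (auto simp: h_def)
  also have "\<dots> = A / (2 * (M + 1))" using assms by (simp add: powr_powr)
  finally have "M * h powr \<epsilon> \<le> M * (A / (2 * (M + 1)))" using assms by (intro mult_left_mono)
  also have "\<dots> < A"
  proof -
    have "0 < A * M + A * 2" using assms by (intro add_nonneg_pos) auto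
    then show ?thesis using assms by (simp add: field_simps)
  qed
  finally have "M * h powr \<epsilon> < A" .
  moreover have "A * h powr \<beta> \<le> (M * h powr \<epsilon>) * h powr \<beta>"
    using le[OF h] by (simp add: powr_add mult_ac)
  then have "A \<le> M * h powr \<epsilon>" using h by simp
  ultimately show False by simp
qed

section \<open>The cosine series and uniform bounds on its coefficients\<close>

text \<open>The weight (k+1)^4 makes \<open>b k\<close> times the square of the symbol summable.
  Since \<open>f\<close> and every \<open>W k\<close> vanish at time -1, the comparison estimates
  start from zero data, with constants independent of k.\<close>

locale heat_series =
  fixes s \<beta> :: real and e :: "'a::euclidean_space" and b :: "nat \<Rightarrow> real"
    and f :: "real \<Rightarrow> real" and W :: "nat \<Rightarrow> real \<Rightarrow> real"
  assumes s: "0 < s" "s < 1" and \<beta>: "0 < \<beta>" and e: "norm e = 1"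
    and b: "summable (\<lambda>k. \<bar>b k\<bar> * real (Suc k) ^ 4)"
    and f_init: "f (-1) = 0"
    and f_holder: "\<And>t r. \<bar>f t - f r\<bar> \<le> \<bar>t - r\<bar> powr \<beta>"
    and W_init: "\<And>k. W k (-1) = 0"
    and W_deriv: "\<And>k t. t \<in> {-1..0} \<Longrightarrow>
      (W k has_real_derivative frac_symbol s (real k *\<^sub>R e) * (f t - W k t)) (at t within {-1..0})"
begin

abbreviation m :: "nat \<Rightarrow> real" where
  "m k \<equiv> frac_symbol s (real k *\<^sub>R e)"

definition v :: "real \<times> 'a \<Rightarrow> real" where
  "v z = (\<Sum>k. b k * (f (fst z) - W k (fst z)) * cos (real k * (e \<bullet> snd z)))"

lemma m_nonneg: "m k \<ge> 0"
  by (rule frac_symbol_nonneg[OF s])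

lemma m_bound:
  obtains C where "C \<ge> 0" "\<And>k. m k \<le> C * real (Suc k) ^ 2"
proof -
  obtain C where C: "C \<ge> 0" "\<And>\<xi>::'a. frac_symbol s \<xi> \<le> C * (1 + (norm \<xi>)\<^sup>2)"
    using frac_symbol_le[OF s] by blast
  have "m k \<le> C * real (Suc k) ^ 2" for k
  proof -
    have "m k \<le> C * (1 + (real k)\<^sup>2)" using C(2)[of "real k *\<^sub>R e"] e by simp
    also have "\<dots> \<le> C * real (Suc k) ^ 2"
      using C(1) by (intro mult_left_mono) (auto simp: power2_eq_square algebra_simps)
    finally show ?thesis .
  qed
  then show ?thesis using that C(1) by blast
qed

lemma b_summable: "j \<le> 4 \<Longrightarrow> summable (\<lambda>k. \<bar>b k\<bar> * real (Suc k) ^ j)"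
  by (rule summable_comparison_test'[OF b, of 0]) (auto intro!: mult_left_mono power_increasing)

lemma b_abs_summable: "summable (\<lambda>k. \<bar>b k\<bar>)"
  using b_summable[of 0] by simp

lemma f_bound: "t \<in> {-1..0} \<Longrightarrow> \<bar>f t\<bar> \<le> 1"
proof -
  assume t: "t \<in> {-1..0}"
  have "\<bar>f t\<bar> \<le> \<bar>t + 1\<bar> powr \<beta>" using f_holder[of t "-1"] f_init by simp
  also have "\<dots> \<le> 1" using t \<beta> by (intro powr_le1) auto
  finally show ?thesis .
qed

lemma f_continuous: "continuous_on A f"
proof (rule continuous_on_subset[OF _ subset_UNIV], unfold continuous_on_eq_continuous_at[OF open_UNIV], rule ballI)
  fix t :: real
  have "((\<lambda>r. \<bar>r - t\<bar> powr \<beta>) \<longlongrightarrow> 0) (at t)"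
  proof -
    have "((\<lambda>r. \<bar>r - t\<bar> powr \<beta>) \<longlongrightarrow> \<bar>t - t\<bar> powr \<beta>) (at t)"
      by (rule tendsto_powr') (use \<beta> in \<open>auto intro!: tendsto_eq_intros always_eventually\<close>)
    then show ?thesis by simp
  qed
  then have "((\<lambda>r. f r - f t) \<longlongrightarrow> 0) (at t)"
    by (rule tendsto_rabs_zero_cancel[OF tendsto_sandwich[OF _ _ tendsto_const], rotated 2])
      (auto intro!: always_eventually f_holder)
  then show "isCont f t" by (simp add: isCont_def LIM_zero_iff)
qed

lemma W_bound: "t \<in> {-1..0} \<Longrightarrow> \<bar>W k t\<bar> \<le> 1"
  by (rule relaxation_abs_bound[OF m_nonneg W_deriv f_bound]) (auto simp: W_init)

lemma W_holder: "t \<in> {-1..0} \<Longrightarrow> r \<in> {-1..0} \<Longrightarrow> \<bar>W k t - W k r\<bar> \<le> \<bar>t - r\<bar> powr \<beta>"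
  by (rule relaxation_holder[OF m_nonneg W_deriv f_holder]) (use \<beta> in \<open>auto simp: W_init f_init\<close>)

lemma V_bound: "t \<in> {-1..0} \<Longrightarrow> \<bar>f t - W k t\<bar> \<le> 2"
  using f_bound[of t] W_bound[of t k] by linarith

text \<open>The equation bounds the derivative of \<open>W k\<close> by 2 m k. Compared with
  \<open>W_holder\<close> this gains a full power of time at the price of a factor
  \<open>m k\<close>, which the decay of \<open>b\<close> pays for.\<close>

lemma W_lipschitz: "t \<in> {-1..0} \<Longrightarrow> r \<in> {-1..0} \<Longrightarrow> \<bar>W k t - W k r\<bar> \<le> 2 * m k * \<bar>t - r\<bar>"
proof -
  assume t: "t \<in> {-1..0}" and r: "r \<in> {-1..0}"
  have "norm (W k t - W k r) \<le> (2 * m k) * norm (t - r)"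
  proof (rule field_differentiable_bound[of "{-1..0}", OF _ W_deriv])
    show "norm (m k * (f u - W k u)) \<le> 2 * m k" if "u \<in> {-1..0}" for u
      using mult_left_mono[OF V_bound[OF that, of k] m_nonneg[of k]] m_nonneg[of k] by (simp add: abs_mult)
  qed (use t r in auto)
  then show ?thesis by simp
qed

lemma v_term_bound:
  "t \<in> {-1..0} \<Longrightarrow> \<bar>b k * (f t - W k t) * cos z\<bar> \<le> 2 * \<bar>b k\<bar>"
proof -
  assume "t \<in> {-1..0}"
  then have "\<bar>b k\<bar> * \<bar>f t - W k t\<bar> * \<bar>cos z\<bar> \<le> \<bar>b k\<bar> * 2 * 1"
    by (intro mult_mono V_bound) auto
  then show ?thesis by (simp add: abs_mult)
qed

lemma v_summable:
  "t \<in> {-1..0} \<Longrightarrow> summable (\<lambda>k. \<bar>b k * (f t - W k t) * cos (real k * z)\<bar>)"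
  by (rule summable_comparison_test'[OF summable_mult[OF b_abs_summable, of 2], of 0])
    (use v_term_bound in simp)

section \<open>Joint Hoelder regularity\<close>

text \<open>In the k-th term the time factor is Hoelder with a constant independent of k and the
  cosine with a constant linear in k. Splitting the difference of products leaves a termwise
  constant 4 |b k| (k+1), which is summable.\<close>

lemma v_in_holder_tx:
  assumes \<alpha>: "0 < \<alpha>" "\<alpha> \<le> 1"
  shows "v \<in> holder_tx \<beta> \<alpha> {-1<..<0} UNIV"
proof -
  define B0 where "B0 = (\<Sum>k. 2 * \<bar>b k\<bar>)"
  define B1 where "B1 = (\<Sum>k. 4 * (\<bar>b k\<bar> * real (Suc k) ^ 1))"
  have sm1: "summable (\<lambda>k. 4 * (\<bar>b k\<bar> * real (Suc k) ^ 1))"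
    by (intro summable_mult b_summable) simp
  have bound: "\<bar>v z\<bar> \<le> B0" if "fst z \<in> {-1<..<0}" for z
  proof -
    have "norm (v z) \<le> B0" unfolding v_def B0_def
      by (rule norm_suminf_le) (use that v_term_bound b_abs_summable in \<open>auto intro!: summable_mult\<close>)
    then show ?thesis by simp
  qed
  have diff: "\<bar>v (t, x) - v (t', x')\<bar> \<le> B1 * (\<bar>t - t'\<bar> powr \<beta> + norm (x - x') powr \<alpha>)"
    if t: "t \<in> {-1<..<0}" "t' \<in> {-1<..<0}" for t t' x x'
  proof -
    define Q where "Q = \<bar>t - t'\<bar> powr \<beta> + norm (x - x') powr \<alpha>"
    let ?T = "\<lambda>k t x. b k * (f t - W k t) * cos (real k * (e \<bullet> x))"
    have tt: "t \<in> {-1..0}" "t' \<in> {-1..0}" using t by auto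
    have sm: "summable (\<lambda>k. ?T k t x)" "summable (\<lambda>k. ?T k t' x')"
      using v_summable[OF tt(1)] v_summable[OF tt(2)] by (auto intro: summable_rabs_cancel)
    have le: "\<bar>?T k t x - ?T k t' x'\<bar> \<le> 4 * (\<bar>b k\<bar> * real (Suc k) ^ 1) * Q" for k
    proof -
      define V where "V = (\<lambda>t. f t - W k t)"
      define c where "c = (\<lambda>x. cos (real k * (e \<bullet> x)))"
      have V: "\<bar>V t - V t'\<bar> \<le> 2 * \<bar>t - t'\<bar> powr \<beta>" "\<bar>V t'\<bar> \<le> 2"
        using f_holder[of t t'] W_holder[OF tt, of k] V_bound[OF tt(2), of k] by (auto simp: V_def)
      have c: "\<bar>c x - c x'\<bar> \<le> 2 * real (Suc k) * norm (x - x') powr \<alpha>"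
        unfolding c_def
      proof (rule abs_cos_diff_le_powr)
        have "\<bar>real k * (e \<bullet> x) - real k * (e \<bullet> x')\<bar> = real k * \<bar>e \<bullet> (x - x')\<bar>"
          by (simp add: inner_diff_right abs_mult flip: right_diff_distrib)
        also have "\<dots> \<le> real (Suc k) * norm (x - x')"
          using Cauchy_Schwarz_ineq2[of e "x - x'"] e by (intro mult_mono) auto
        finally show "\<bar>real k * (e \<bullet> x) - real k * (e \<bullet> x')\<bar> \<le> real (Suc k) * norm (x - x')" .
      qed (use \<alpha> in auto)
      have "\<bar>V t * c x - V t' * c x'\<bar> = \<bar>(V t - V t') * c x + V t' * (c x - c x')\<bar>"
        by (simp add: algebra_simps)
      also have "\<dots> \<le> \<bar>V t - V t'\<bar> * \<bar>c x\<bar> + \<bar>V t'\<bar> * \<bar>c x - c x'\<bar>"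
        by (rule order_trans[OF abs_triangle_ineq]) (simp add: abs_mult)
      also have "\<dots> \<le> (2 * \<bar>t - t'\<bar> powr \<beta>) * 1 + 2 * (2 * real (Suc k) * norm (x - x') powr \<alpha>)"
        using V c by (intro add_mono mult_mono) (auto simp: c_def)
      also have "\<dots> \<le> (4 * real (Suc k)) * \<bar>t - t'\<bar> powr \<beta> + (4 * real (Suc k)) * norm (x - x') powr \<alpha>"
      proof (rule add_mono)
        show "2 * \<bar>t - t'\<bar> powr \<beta> * 1 \<le> 4 * real (Suc k) * \<bar>t - t'\<bar> powr \<beta>"
          unfolding mult_1_right by (rule mult_right_mono) auto
      qed (simp add: algebra_simps)
      finally have "\<bar>V t * c x - V t' * c x'\<bar> \<le> 4 * real (Suc k) * Q" by (simp add: Q_def distrib_left)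
      then have "\<bar>b k\<bar> * \<bar>V t * c x - V t' * c x'\<bar> \<le> \<bar>b k\<bar> * (4 * real (Suc k) * Q)"
        by (intro mult_left_mono) auto
      moreover have "?T k t x - ?T k t' x' = b k * (V t * c x - V t' * c x')"
        by (simp add: V_def c_def algebra_simps)
      ultimately show ?thesis by (simp add: abs_mult mult_ac)
    qed
    have "norm (\<Sum>k. ?T k t x - ?T k t' x') \<le> (\<Sum>k. 4 * (\<bar>b k\<bar> * real (Suc k) ^ 1) * Q)"
      by (rule norm_suminf_le) (use le summable_mult2[OF sm1] in simp_all)
    then show ?thesis
      using suminf_diff[OF sm] suminf_mult2[OF sm1, of Q] by (simp add: v_def B1_def Q_def)
  qed
  have "(SUP p \<in> {-1<..<0} \<times> UNIV. ennreal \<bar>v p\<bar>) \<le> ennreal B0"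
    by (rule SUP_least) (use bound in \<open>auto intro!: ennreal_leI\<close>)
  moreover have "(SUP ((t, x), (t', x')) \<in> {(p, q). p \<in> {-1<..<0} \<times> UNIV \<and> q \<in> {-1<..<0} \<times> UNIV \<and> p \<noteq> q}.
        ennreal (\<bar>v (t, x) - v (t', x')\<bar> / (\<bar>t - t'\<bar> powr \<beta> + norm (x - x') powr \<alpha>))) \<le> ennreal B1"
  proof (rule SUP_least)
    fix pq :: "(real \<times> 'a) \<times> (real \<times> 'a)"
    assume asm: "pq \<in> {(p, q). p \<in> {-1<..<0} \<times> UNIV \<and> q \<in> {-1<..<0} \<times> UNIV \<and> p \<noteq> q}"
    obtain t x t' x' where pq: "pq = ((t, x), (t', x'))" by (metis surj_pair)
    have t: "t \<in> {-1<..<0}" "t' \<in> {-1<..<0}" and ne: "(t, x) \<noteq> (t', x')"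
      using asm unfolding pq by auto
    have "\<bar>v (t, x) - v (t', x')\<bar> \<le> B1 * (\<bar>t - t'\<bar> powr \<beta> + norm (x - x') powr \<alpha>)"
      by (rule diff[OF t])
    moreover have "0 < \<bar>t - t'\<bar> powr \<beta> + norm (x - x') powr \<alpha>"
      using ne by (cases "t = t'") (auto intro: add_pos_nonneg)
    ultimately show "(\<lambda>((t, x), (t', x')).
        ennreal (\<bar>v (t, x) - v (t', x')\<bar> / (\<bar>t - t'\<bar> powr \<beta> + norm (x - x') powr \<alpha>))) pq \<le> ennreal B1"
      unfolding pq prod.case by (intro ennreal_leI) (simp add: pos_divide_le_eq)
  qed
  ultimately have "holder_tx_norm \<beta> \<alpha> {-1<..<0} UNIV v \<le> ennreal B0 + ennreal B1"
    unfolding holder_tx_norm_def by (rule add_mono)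
  also have "\<dots> < \<infinity>" by simp
  finally show ?thesis by (simp add: holder_tx_def)
qed

section \<open>The weak equation\<close>

text \<open>For each k the fractional Laplacian gives a factor \<open>m k\<close>, and an
  integration by parts in time of W k \<eta> removes \<open>W k\<close>. What remains is f times the
  time derivative of \<eta> times b k cos (k e \<bullet> x), and the sum over k vanishes on the
  support of \<eta>. The time derivative always falls on \<eta>, so \<open>f\<close> is never
  differentiated.\<close>

lemma v_weak_solution:
  assumes g0: "\<And>x. norm x < 1 \<Longrightarrow> (\<lambda>k. b k * cos (real k * (e \<bullet> x))) sums 0"
  shows "frac_heat_weak_solution s {-1<..<0} (ball 0 1) v"
  unfolding frac_heat_weak_solution_def Let_def
proof (rule ballI)
  fix \<eta> :: "real \<times> 'a \<Rightarrow> real"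
  assume "\<eta> \<in> test_functions ({-1<..<0} \<times> ball 0 1)"
  then have Ck: "\<And>k. Ck k \<eta>" and comp: "compact (closure {z. \<eta> z \<noteq> 0})"
    and supp: "closure {z. \<eta> z \<noteq> 0} \<subseteq> {-1<..<0} \<times> ball 0 1"
    by (auto simp: test_functions_def)
  define K where "K = closure {z. \<eta> z \<noteq> 0}"
  define D where "D z = frechet_derivative \<eta> (at z) (1, 0)" for z
  define L where "L z = frac_lap s (\<lambda>x. \<eta> (fst z, x)) (snd z)" for z
  define c where "c k x = cos (real k * (e \<bullet> x))" for k :: nat and x :: 'a
  \<comment> \<open>\<open>W k\<close> is controlled on [-1,0] only. The cutoff makes
    \<open>U k\<close> bounded and measurable on all of space-time and, depending on time alone,
    leaves the spatial translation identity intact.\<close>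
  define VI where "VI k t = indicator {-1<..<0} t * (f t - W k t)" for k and t :: real
  define U where "U k z = VI k (fst z) * c k (snd z)" for k and z :: "real \<times> 'a"
  define F where "F = (\<lambda>(t, x). v (t, x) * (- deriv (\<lambda>\<tau>. \<eta> (\<tau>, x)) t + frac_lap s (\<lambda>z. \<eta> (t, z)) x))"

  have K: "compact K" using comp by (simp add: K_def)
  have \<eta>0: "\<eta> z = 0" if "z \<notin> K" for z
    using that closure_subset[of "{z. \<eta> z \<noteq> 0}"] unfolding K_def by blast
  have D0: "D z = 0" if "z \<notin> K" for z
    using that frechet_derivative_eq_0_outside_support(2) unfolding K_def D_def by blast
  have \<eta>_cont: "continuous_on UNIV \<eta>" using Ck[of 0] by simp
  have \<eta>_diff: "\<eta> differentiable (at z)" for z using Ck[of 1] unfolding One_nat_def Ck.simps(2) by blast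
  have D_cont: "continuous_on UNIV D" unfolding D_def using Ck[of 1] by simp
  have D_deriv: "((\<lambda>\<tau>. \<eta> (\<tau>, x)) has_real_derivative D (t, x)) (at t)" for t x
    unfolding D_def by (rule deriv_fst_eq_frechet_derivative[OF \<eta>_diff])
  obtain C where "C \<ge> 0" and C: "\<And>z h. \<bar>\<eta> (z + h) + \<eta> (z - h) - 2 * \<eta> z\<bar> \<le> C * min 1 ((norm h)\<^sup>2)"
    by (rule Ck_2_second_difference_bound[OF Ck comp subset_refl]) (rule that)

  have L_int: "integrable lborel L"
    unfolding L_def by (rule integrable_frac_lap[OF s \<eta>_cont K \<eta>0 C])
  have \<eta>_int: "integrable lborel \<eta>" by (rule integrable_compact_support[OF \<eta>_cont K \<eta>0])
  have D_int: "integrable lborel D" by (rule integrable_compact_support[OF D_cont K D0])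
  have c_cont: "continuous_on A (\<lambda>z. c k (snd z))" for A :: "(real \<times> 'a) set" and k
    unfolding c_def by (intro continuous_intros)
  have fD_int: "integrable lborel (\<lambda>z. c k (snd z) * (f (fst z) * D z))" for k
    by (rule integrable_compact_support[OF _ K])
      (auto intro!: continuous_intros c_cont D_cont continuous_on_compose2[OF f_continuous] simp: D0)

  have VI_meas: "VI k \<in> borel_measurable borel" for k
  proof -
    have "continuous_on {-1..0} (W k)"
      using W_deriv[of _ k] DERIV_continuous unfolding continuous_on_eq_continuous_within by blast
    then have "continuous_on {-1<..<0} (\<lambda>t. f t - W k t)"
      by (intro continuous_intros f_continuous) (auto elim: continuous_on_subset)
    then have "(\<lambda>t. indicator {-1<..<0} t *\<^sub>R (f t - W k t)) \<in> borel_measurable borel"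
      by (rule borel_measurable_continuous_on_indicator[rotated]) simp
    then show ?thesis by (simp add: VI_def[abs_def])
  qed
  have U_meas: "U k \<in> borel_measurable borel" for k
  proof -
    have [measurable]: "(\<lambda>z. VI k (fst z)) \<in> borel_measurable (borel :: (real \<times> 'a) measure)"
      by (rule measurable_compose[OF _ VI_meas]) (simp add: borel_prod[symmetric])
    have [measurable]: "(\<lambda>z. c k (snd z)) \<in> borel_measurable (borel :: (real \<times> 'a) measure)"
      by (rule borel_measurable_continuous_onI[OF c_cont])
    show ?thesis unfolding U_def[abs_def] by measurable
  qed
  have VI_bound: "\<bar>VI k t\<bar> \<le> 2" for k t
    using V_bound[of t k] by (auto simp: VI_def indicator_def)
  have U_bound: "\<bar>U k z\<bar> \<le> 2" for k z
    unfolding U_def abs_mult using mult_mono[OF VI_bound[of k "fst z"], of "\<bar>c k (snd z)\<bar>" 1]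
    by (simp add: c_def)

  have U_translate: "U k (z + (0, y)) + U k (z - (0, y)) = 2 * cos ((real k *\<^sub>R e) \<bullet> y) * U k z" for k z y
  proof -
    obtain t x where z: "z = (t, x)" by (cases z)
    define A B where "A = real k * (e \<bullet> x)" and "B = real k * (e \<bullet> y)"
    have "U k (z + (0, y)) + U k (z - (0, y)) = VI k t * (cos (A + B) + cos (A - B))"
      by (simp add: U_def c_def z A_def B_def inner_add_right inner_diff_right distrib_left right_diff_distrib)
    also have "\<dots> = 2 * cos B * (VI k t * cos A)"
      by (simp add: cos_add cos_diff)
    finally show ?thesis by (simp add: U_def c_def z A_def B_def)
  qed
  have UL: "(\<integral>z. U k z * L z \<partial>lborel) = m k * (\<integral>z. U k z * \<eta> z \<partial>lborel)" for k
    unfolding L_def by (rule integral_mult_frac_lap[OF s \<eta>_cont K \<eta>0 C U_meas U_bound U_translate])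
  have U_int: "integrable lborel (\<lambda>z. U k z * h z)" if "integrable lborel h" for k h
    by (rule integrable_mult_bounded[OF that _ U_bound]) (use U_meas in simp)

  have time: "(\<integral>z. m k * (U k z * \<eta> z) - U k z * D z + c k (snd z) * (f (fst z) * D z) \<partial>lborel) = 0" for k
  proof -
    \<comment> \<open>By the equation for \<open>W k\<close> the bracket is the time derivative of W
      k \<eta>. The closed interval suits the fundamental theorem of calculus; outside the open one
      \<open>\<eta>\<close> and \<open>D\<close> vanish, so the integrand is unchanged.\<close>
    define H where "H x t = c k x * (indicator {-1..0} t * (m k * (f t - W k t) * \<eta> (t, x) + W k t * D (t, x)))" for x t
    have H: "m k * (U k z * \<eta> z) - U k z * D z + c k (snd z) * (f (fst z) * D z) = H (snd z) (fst z)" for z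
    proof (cases "fst z \<in> {-1<..<0}")
      case True
      then show ?thesis by (cases z) (simp add: H_def U_def VI_def algebra_simps)
    next
      case False
      then have "z \<notin> K" using supp by (auto simp: K_def)
      then show ?thesis using \<eta>0 D0 by (cases z) (simp add: H_def)
    qed
    have "integrable lborel (\<lambda>z. H (snd z) (fst z))"
      unfolding H[symmetric]
      by (intro Bochner_Integration.integrable_add Bochner_Integration.integrable_diff integrable_mult_right U_int \<eta>_int D_int fD_int)
    then have Hint: "integrable (lborel \<Otimes>\<^sub>M lborel) (\<lambda>(t, x). H x t)"
      by (simp add: lborel_prod case_prod_beta')
    have "(\<integral>t. H x t \<partial>lborel) = 0" for x
    proof -
      have "has_bochner_integral lborel (\<lambda>t. indicator {-1..0} t *\<^sub>R (m k * (f t - W k t) * \<eta> (t, x) + W k t * D (t, x)))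
          (W k 0 * \<eta> (0, x) - W k (-1) * \<eta> (-1, x))"
      proof (rule has_bochner_integral_FTC_Icc)
        fix t :: real assume "-1 \<le> t" "t \<le> 0"
        then have t: "t \<in> {-1..0}" by simp
        have "((\<lambda>t. W k t * \<eta> (t, x)) has_real_derivative m k * (f t - W k t) * \<eta> (t, x) + D (t, x) * W k t) (at t within {-1..0})"
          by (rule DERIV_mult[OF W_deriv[OF t] has_field_derivative_at_within[OF D_deriv]])
        then show "((\<lambda>t. W k t * \<eta> (t, x)) has_vector_derivative m k * (f t - W k t) * \<eta> (t, x) + W k t * D (t, x)) (at t within {-1..0})"
          by (simp add: has_real_derivative_iff_has_vector_derivative mult.commute)
      next
        have "continuous_on {-1..0} (W k)"
          using W_deriv[of _ k] DERIV_continuous unfolding continuous_on_eq_continuous_within by blast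
        then show "continuous_on {-1..0} (\<lambda>t. m k * (f t - W k t) * \<eta> (t, x) + W k t * D (t, x))"
          by (intro continuous_intros f_continuous continuous_on_compose2[OF \<eta>_cont] continuous_on_compose2[OF D_cont]) auto
      qed simp
      \<comment> \<open>The boundary term at time -1 vanishes as well, since
        \<open>W k (-1) = 0\<close>.\<close>
      moreover have "\<eta> (0, x) = 0" using supp by (intro \<eta>0) (auto simp: K_def)
      ultimately have "(\<integral>t. indicator {-1..0} t *\<^sub>R (m k * (f t - W k t) * \<eta> (t, x) + W k t * D (t, x)) \<partial>lborel) = 0"
        by (simp add: has_bochner_integral_integral_eq W_init)
      then show ?thesis unfolding H_def by simp
    qed
    then have "(\<integral>x. \<integral>t. H x t \<partial>lborel \<partial>lborel) = 0" by simp
    then have "integral\<^sup>L (lborel \<Otimes>\<^sub>M lborel) (\<lambda>(t, x). H x t) = 0"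
      using lborel_pair.integral_snd[OF Hint] by simp
    then show ?thesis unfolding H by (simp add: lborel_prod case_prod_beta')
  qed
  \<comment> \<open>On the right-hand side the index k enters only through b k cos (k e \<bullet>
    x), so the series can be summed inside the integral.\<close>
  have term_eq: "(\<integral>z. b k * (U k z * (L z - D z)) \<partial>lborel) = (\<integral>z. - (b k * c k (snd z) * (f (fst z) * D z)) \<partial>lborel)" for k
  proof -
    have "m k * (\<integral>z. U k z * \<eta> z \<partial>lborel) - (\<integral>z. U k z * D z \<partial>lborel) + (\<integral>z. c k (snd z) * (f (fst z) * D z) \<partial>lborel) = 0"
      using time[of k] U_int[OF \<eta>_int, of k] U_int[OF D_int, of k] fD_int[of k] by simp
    then have "(\<integral>z. U k z * L z \<partial>lborel) - (\<integral>z. U k z * D z \<partial>lborel) = - (\<integral>z. c k (snd z) * (f (fst z) * D z) \<partial>lborel)"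
      unfolding UL by simp
    then have "(\<integral>z. U k z * (L z - D z) \<partial>lborel) = - (\<integral>z. c k (snd z) * (f (fst z) * D z) \<partial>lborel)"
      using U_int[OF L_int, of k] U_int[OF D_int, of k] by (simp add: right_diff_distrib)
    then show ?thesis by (simp add: mult.assoc)
  qed

  have \<Phi>_int: "integrable lborel (\<lambda>z. L z - D z)" using L_int D_int by simp
  have F_eq: "indicator ({-1<..<0} \<times> UNIV) z *\<^sub>R F z = (\<Sum>k. b k * (U k z * (L z - D z)))" for z
  proof (cases "fst z \<in> {-1<..<0}")
    case True
    have "summable (\<lambda>k. b k * (f (fst z) - W k (fst z)) * cos (real k * (e \<bullet> snd z)))"
      by (rule summable_rabs_cancel[OF v_summable]) (use True in auto)
    then have "v z * (L z - D z) = (\<Sum>k. b k * (f (fst z) - W k (fst z)) * cos (real k * (e \<bullet> snd z)) * (L z - D z))"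
      unfolding v_def by (rule suminf_mult2)
    moreover have "F z = v z * (L z - D z)"
      by (cases z) (simp add: F_def L_def DERIV_imp_deriv[OF D_deriv])
    ultimately show ?thesis
      using True by (cases z) (simp add: U_def VI_def c_def mult.assoc)
  next
    case False
    then show ?thesis by (cases z) (simp add: U_def VI_def)
  qed
  have sum1: "summable (\<lambda>k. norm (b k * (U k z * h)))" for z h
  proof (rule summable_comparison_test'[OF summable_mult2[OF b_abs_summable, of "2 * \<bar>h\<bar>"], of 0])
    show "norm (norm (b k * (U k z * h))) \<le> \<bar>b k\<bar> * (2 * \<bar>h\<bar>)" for k
      using U_bound[of k z] by (auto simp: abs_mult intro!: mult_left_mono mult_right_mono)
  qed
  \<comment> \<open>The majorant 2 |b k| |h| has integrals summable in k, which justifies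
    integrating the series term by term.\<close>
  have sum2: "summable (\<lambda>k. \<integral>z. norm (b k * (U k z * h z)) \<partial>lborel)" if h: "integrable lborel h" for h
  proof (rule summable_comparison_test'[OF summable_mult2[OF b_abs_summable, of "2 * (\<integral>z. \<bar>h z\<bar> \<partial>lborel)"], of 0])
    fix k
    have "(\<integral>z. norm (b k * (U k z * h z)) \<partial>lborel) \<le> (\<integral>z. (\<bar>b k\<bar> * 2) * \<bar>h z\<bar> \<partial>lborel)"
    proof (intro integral_mono integrable_norm integrable_mult_right integrable_abs U_int h)
      show "norm (b k * (U k z * h z)) \<le> (\<bar>b k\<bar> * 2) * \<bar>h z\<bar>" for z
        using U_bound[of k z] by (auto simp: abs_mult mult.assoc intro!: mult_left_mono mult_right_mono)
    qed
    then show "norm (\<integral>z. norm (b k * (U k z * h z)) \<partial>lborel) \<le> \<bar>b k\<bar> * (2 * (\<integral>z. \<bar>h z\<bar> \<partial>lborel))"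
      by (simp add: integral_nonneg_AE)
  qed
  have "integrable lborel (\<lambda>z. \<Sum>k. b k * (U k z * (L z - D z)))"
    by (rule integrable_suminf) (use sum1 sum2[OF \<Phi>_int] U_int[OF \<Phi>_int] in auto)
  then have int_F: "integrable lborel (\<lambda>z. indicator ({-1<..<0} \<times> UNIV) z *\<^sub>R F z)"
    unfolding F_eq .
  have "(\<integral>z. indicator ({-1<..<0} \<times> UNIV) z *\<^sub>R F z \<partial>lborel) = (\<Sum>k. \<integral>z. b k * (U k z * (L z - D z)) \<partial>lborel)"
    unfolding F_eq by (rule integral_suminf) (use sum1 sum2[OF \<Phi>_int] U_int[OF \<Phi>_int] in auto)
  also have "\<dots> = (\<Sum>k. \<integral>z. - (b k * c k (snd z) * (f (fst z) * D z)) \<partial>lborel)"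
    unfolding term_eq ..
  also have "\<dots> = (\<integral>z. (\<Sum>k. - (b k * c k (snd z) * (f (fst z) * D z))) \<partial>lborel)"
  proof (rule integral_suminf[symmetric])
    show "integrable lborel (\<lambda>z. - (b k * c k (snd z) * (f (fst z) * D z)))" for k
      using fD_int[of k] by (simp add: mult.assoc)
    have fD_int': "integrable lborel (\<lambda>z. f (fst z) * D z)" using fD_int[of 0] by (simp add: c_def)
    have le: "norm (- (b k * c k (snd z) * (f (fst z) * D z))) \<le> \<bar>b k\<bar> * \<bar>f (fst z) * D z\<bar>" for k z
      by (auto simp: abs_mult c_def intro!: mult_right_mono mult_left_le)
    show "AE z in lborel. summable (\<lambda>k. norm (- (b k * c k (snd z) * (f (fst z) * D z))))"
    proof (rule AE_I2)
      fix z
      show "summable (\<lambda>k. norm (- (b k * c k (snd z) * (f (fst z) * D z))))"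
        by (rule summable_comparison_test'[OF summable_mult2[OF b_abs_summable, of "\<bar>f (fst z) * D z\<bar>"], of 0])
          (use le[of _ z] in simp)
    qed
    show "summable (\<lambda>k. \<integral>z. norm (- (b k * c k (snd z) * (f (fst z) * D z))) \<partial>lborel)"
    proof (rule summable_comparison_test'[OF summable_mult2[OF b_abs_summable, of "\<integral>z. \<bar>f (fst z) * D z\<bar> \<partial>lborel"], of 0])
      fix k
      have "(\<integral>z. norm (- (b k * c k (snd z) * (f (fst z) * D z))) \<partial>lborel) \<le> (\<integral>z. \<bar>b k\<bar> * \<bar>f (fst z) * D z\<bar> \<partial>lborel)"
      proof (rule integral_mono[OF _ _ le])
        show "integrable lborel (\<lambda>z. norm (- (b k * c k (snd z) * (f (fst z) * D z))))"
          using integrable_norm[OF integrable_mult_right[OF fD_int[of k], of "- b k"]] by (simp add: mult.assoc)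
      qed (intro integrable_mult_right integrable_abs fD_int')
      then show "norm (\<integral>z. norm (- (b k * c k (snd z) * (f (fst z) * D z))) \<partial>lborel) \<le> \<bar>b k\<bar> * (\<integral>z. \<bar>f (fst z) * D z\<bar> \<partial>lborel)"
        by (simp add: integral_nonneg_AE)
    qed
  qed
  \<comment> \<open>On \<open>K\<close> the point lies over the unit ball, where the cosine series
    sums to 0; off \<open>K\<close> the factor \<open>D\<close> vanishes.\<close>
  also have "(\<lambda>z. \<Sum>k. - (b k * c k (snd z) * (f (fst z) * D z))) = (\<lambda>z. 0)"
  proof
    fix z
    show "(\<Sum>k. - (b k * c k (snd z) * (f (fst z) * D z))) = 0"
    proof (cases "z \<in> K")
      case True
      then have "norm (snd z) < 1" using supp by (auto simp: K_def)
      from sums_mult2[OF g0[OF this], of "- (f (fst z) * D z)"] show ?thesis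
        by (simp add: sums_iff c_def)
    next
      case False
      then show ?thesis by (simp add: D0)
    qed
  qed
  finally show "set_integrable lborel ({-1<..<0} \<times> UNIV) (\<lambda>(t, x). v (t, x) * (- deriv (\<lambda>\<tau>. \<eta> (\<tau>, x)) t + frac_lap s (\<lambda>z. \<eta> (t, z)) x)) \<and>
      set_lebesgue_integral lborel ({-1<..<0} \<times> UNIV) (\<lambda>(t, x). v (t, x) * (- deriv (\<lambda>\<tau>. \<eta> (\<tau>, x)) t + frac_lap s (\<lambda>z. \<eta> (t, z)) x)) = 0"
    using int_F by (simp add: F_def set_integrable_def set_lebesgue_integral_def)
qed

section \<open>Failure of Hoelder regularity of the time derivative at the origin\<close>

definition A :: real where "A = (\<Sum>k. b k * m k)"

text \<open>The symbol is at most quadratic in k, so \<open>m k ^ 2\<close> just fits under the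
  weight (k+1)^4. The case j = 1 serves \<open>A\<close> and termwise differentiation, the case j =
  2 the Lipschitz bound.\<close>

lemma bm_summable:
  assumes "j \<le> 2"
  shows "summable (\<lambda>k. \<bar>b k\<bar> * m k ^ j)"
proof -
  obtain C where C: "C \<ge> 0" "\<And>k. m k \<le> C * real (Suc k) ^ 2" using m_bound by blast
  show ?thesis
  proof (rule summable_comparison_test'[OF summable_mult[OF b_summable[of "2 * j"], of "C ^ j"], of 0])
    fix k
    have "m k ^ j \<le> (C * real (Suc k) ^ 2) ^ j" by (rule power_mono[OF C(2) m_nonneg])
    then have "\<bar>b k\<bar> * m k ^ j \<le> \<bar>b k\<bar> * (C * real (Suc k) ^ 2) ^ j" by (intro mult_left_mono) auto
    then show "norm (\<bar>b k\<bar> * m k ^ j) \<le> C ^ j * (\<bar>b k\<bar> * real (Suc k) ^ (2 * j))"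
      using m_nonneg[of k] by (simp only: power_mult_distrib power_mult) (simp add: mult_ac del: of_nat_Suc)
  qed (use assms in auto)
qed

text \<open>Exchanging the sum with the Levy integral writes \<open>A\<close> as a positive constant
  times minus the integral of 2 bump (e \<bullet> y) over the kernel weight. The integrand is
  nonnegative and positive near pi e, so \<open>A\<close> is negative.\<close>

lemma A_nonzero:
  assumes g: "\<And>r. (\<lambda>k. b k * cos (real k * r)) sums bump r"
  shows "A \<noteq> 0"
proof -
  define \<kappa> where "\<kappa> y = norm y powr (real DIM('a) + 2 * s)" for y :: 'a
  define c where "c = frac_lap_const TYPE('a) s"
  define h where "h k y = (2 - 2 * cos ((real k *\<^sub>R e) \<bullet> y)) / \<kappa> y" for k y
  have c: "c > 0" unfolding c_def by (rule frac_lap_const_pos[OF s])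
  have h_int: "integrable lborel (h k)" for k
    unfolding h_def[abs_def] \<kappa>_def by (rule integrable_frac_symbol[OF s])
  have h_nonneg: "h k y \<ge> 0" for k y by (simp add: h_def \<kappa>_def)
  have mh: "integral\<^sup>L lborel (h k) = m k / c" for k
    using c by (simp add: frac_symbol_def c_def h_def[abs_def] \<kappa>_def)
  have b0: "(\<lambda>k. b k) sums 0" using g[of 0] by (simp add: bump_def)
  \<comment> \<open>The coefficients sum to \<open>bump 0 = 0\<close>, so the constant parts of 2 -
    2 cos cancel and only the cosine parts survive.\<close>
  have sums: "(\<lambda>k. b k * h k y) sums (- 2 * bump (e \<bullet> y) / \<kappa> y)" for y
  proof -
    have "(\<lambda>k. (2 * b k - 2 * (b k * cos (real k * (e \<bullet> y)))) / \<kappa> y) sums ((2 * 0 - 2 * bump (e \<bullet> y)) / \<kappa> y)"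
      by (intro sums_divide sums_diff sums_mult b0 g)
    then show ?thesis by (simp add: h_def algebra_simps)
  qed
  have int: "integrable lborel (\<lambda>y. b k * h k y)" for k using h_int by simp
  have sm: "AE y in lborel. summable (\<lambda>k. norm (b k * h k y))"
  proof (rule AE_I2)
    fix y
    have "summable (\<lambda>k. \<bar>b k\<bar> * (4 / \<kappa> y))" by (intro summable_mult2 b_abs_summable)
    then show "summable (\<lambda>k. norm (b k * h k y))"
    proof (rule summable_comparison_test'[of _ 0])
      fix k
      have "2 - 2 * cos ((real k *\<^sub>R e) \<bullet> y) \<le> 4" using cos_ge_minus_one[of "(real k *\<^sub>R e) \<bullet> y"] by linarith
      then have "h k y \<le> 4 / \<kappa> y" unfolding h_def by (intro divide_right_mono) (auto simp: \<kappa>_def)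
      then show "norm (norm (b k * h k y)) \<le> \<bar>b k\<bar> * (4 / \<kappa> y)"
        using h_nonneg[of k y] by (simp add: abs_mult mult_left_mono del: times_divide_eq_right)
    qed
  qed
  have sm': "summable (\<lambda>k. \<integral>y. norm (b k * h k y) \<partial>lborel)"
  proof -
    have "(\<integral>y. norm (b k * h k y) \<partial>lborel) = \<bar>b k\<bar> * m k ^ 1 / c" for k
      using h_nonneg by (simp add: abs_mult mh)
    then show ?thesis using summable_divide[OF bm_summable[of 1], of c] by simp
  qed
  have J_int: "integrable lborel (\<lambda>y. - 2 * bump (e \<bullet> y) / \<kappa> y)"
    using integrable_suminf[OF int sm sm'] unfolding sums_unique[OF sums, symmetric] .
  have "(\<Sum>k. integral\<^sup>L lborel (\<lambda>y. b k * h k y)) = (\<integral>y. - 2 * bump (e \<bullet> y) / \<kappa> y \<partial>lborel)"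
    using integral_suminf[OF int sm sm'] unfolding sums_unique[OF sums, symmetric] by simp
  then have "(\<Sum>k. b k * m k / c) = - (\<integral>y. 2 * bump (e \<bullet> y) / \<kappa> y \<partial>lborel)"
    using mh by simp
  moreover have "(\<Sum>k. b k * m k / c) = A / c"
  proof -
    have "summable (\<lambda>k. b k * m k)"
      by (rule summable_rabs_cancel) (use bm_summable[of 1] m_nonneg in \<open>simp add: abs_mult\<close>)
    then show ?thesis unfolding A_def by (rule suminf_divide)
  qed
  moreover have "(\<integral>y. 2 * bump (e \<bullet> y) / \<kappa> y \<partial>lborel) > 0"
  proof (rule integral_pos_of_pos_on_open)
    show "integrable lborel (\<lambda>y. 2 * bump (e \<bullet> y) / \<kappa> y)"
      using Bochner_Integration.integrable_minus[OF J_int] by simp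
    show "2 * bump (e \<bullet> y) / \<kappa> y \<ge> 0" for y by (simp add: bump_def \<kappa>_def)
    \<comment> \<open>On this ball e \<bullet> y is within 1 of pi, so its cosine is negative and
      \<open>bump\<close> is positive.\<close>
    show "open (ball (pi *\<^sub>R e) 1)" "ball (pi *\<^sub>R e) 1 \<noteq> {}" by auto
    fix y assume y: "y \<in> ball (pi *\<^sub>R e) 1"
    have ee: "e \<bullet> e = 1" using e by (simp add: norm_eq_1)
    have "\<bar>e \<bullet> (y - pi *\<^sub>R e)\<bar> < 1"
      using Cauchy_Schwarz_ineq2[of e "y - pi *\<^sub>R e"] y e by (simp add: dist_norm norm_minus_commute)
    then have r: "\<bar>e \<bullet> y - pi\<bar> < 1" by (simp add: inner_diff_right ee)
    have "cos (e \<bullet> y - pi) > 0"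
      by (rule cos_gt_zero_pi) (use r pi_gt3 in auto)
    then have "bump (e \<bullet> y) > 0" by (simp add: bump_def)
    moreover have "y \<noteq> 0" using r pi_gt3 by auto
    ultimately show "0 < 2 * bump (e \<bullet> y) / \<kappa> y" by (simp add: \<kappa>_def)
  qed
  ultimately show ?thesis by auto
qed

text \<open>Since the \<open>b k\<close> sum to 0, the rough function \<open>f\<close> cancels from
  \<open>v\<close> at the origin, leaving minus the sum of b k W k. This series can be
  differentiated termwise, and \<open>f\<close> reappears in the derivative with factor - A.\<close>

lemma v_at_0_deriv:
  assumes b0: "(\<lambda>k. b k) sums 0" and t: "t \<in> {-1<..<0}"
  shows "((\<lambda>t. v (t, 0)) has_real_derivative (\<Sum>k. b k * m k * W k t) - A * f t) (at t)"
proof -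
  have bm: "summable (\<lambda>k. b k * m k)"
    by (rule summable_rabs_cancel) (use bm_summable[of 1] m_nonneg in \<open>simp add: abs_mult\<close>)
  have le: "\<bar>b k * m k * W k r\<bar> \<le> \<bar>b k\<bar> * m k ^ 1" if "r \<in> {-1..0}" for k r
    using W_bound[OF that, of k] m_nonneg[of k] by (simp add: abs_mult mult_left_le mult_nonneg_nonneg)
  have bmW: "summable (\<lambda>k. b k * m k * W k r)" if "r \<in> {-1..0}" for r
    by (rule summable_comparison_test'[OF bm_summable[of 1], of 0]) (use le[OF that] in auto)
  have Wsm: "summable (\<lambda>k. b k * W k r)" if "r \<in> {-1..0}" for r
    by (rule summable_comparison_test'[OF b_abs_summable, of 0])
      (use W_bound[OF that] in \<open>auto simp: abs_mult intro!: mult_left_le\<close>)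
  have "((\<lambda>t. \<Sum>k. - (b k * W k t)) has_real_derivative (\<Sum>k. - (b k * (m k * (f t - W k t))))) (at t)"
  proof (rule has_field_derivative_series'(2)[of "{-1..0}"])
    show "((\<lambda>t. - (b k * W k t)) has_real_derivative - (b k * (m k * (f r - W k r)))) (at r within {-1..0})"
      if "r \<in> {-1..0}" for k r
      by (intro DERIV_minus DERIV_cmult W_deriv that)
    show "uniformly_convergent_on {-1..0} (\<lambda>n r. \<Sum>k<n. - (b k * (m k * (f r - W k r))))"
    proof (rule Weierstrass_m_test'[of _ _ "\<lambda>k. 2 * (\<bar>b k\<bar> * m k ^ 1)"])
      show "norm (- (b k * (m k * (f r - W k r)))) \<le> 2 * (\<bar>b k\<bar> * m k ^ 1)" if "r \<in> {-1..0}" for k r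
        using mult_left_mono[OF V_bound[OF that, of k], of "\<bar>b k\<bar> * m k"] m_nonneg[of k]
        by (simp add: abs_mult mult_ac)
      show "summable (\<lambda>k. 2 * (\<bar>b k\<bar> * m k ^ 1))" by (intro summable_mult bm_summable) simp
    qed
    show "summable (\<lambda>k. - (b k * W k t))" using Wsm[of t] t by (intro summable_minus) auto
  qed (use t in auto)
  also have "(\<Sum>k. - (b k * (m k * (f t - W k t)))) = (\<Sum>k. b k * m k * W k t - b k * m k * f t)"
    by (simp add: algebra_simps)
  also have "\<dots> = (\<Sum>k. b k * m k * W k t) - A * f t"
  proof -
    have "t \<in> {-1..0}" using t by simp
    from suminf_diff[OF bmW[OF this] summable_mult2[OF bm, of "f t"]] show ?thesis
      unfolding A_def by (simp only: suminf_mult2[OF bm])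
  qed
  finally have "((\<lambda>t. \<Sum>k. - (b k * W k t)) has_real_derivative (\<Sum>k. b k * m k * W k t) - A * f t) (at t)" .
  then show ?thesis
  proof (rule has_field_derivative_transform_within_open[of _ _ _ "{-1<..<0}"])
    fix r :: real assume "r \<in> {-1<..<0}"
    then have r: "r \<in> {-1..0}" by simp
    have "(\<lambda>k. b k * f r - b k * W k r) sums (0 * f r - (\<Sum>k. b k * W k r))"
      by (intro sums_diff sums_mult2 b0 summable_sums Wsm r)
    then have "v (r, 0) = - (\<Sum>k. b k * W k r)"
      by (simp add: v_def sums_iff right_diff_distrib)
    then show "(\<Sum>k. - (b k * W k r)) = v (r, 0)" by (simp add: suminf_minus[OF Wsm[OF r]])
  qed (use t in auto)
qed

text \<open>The Lipschitz constant of \<open>W k\<close> contributes a second factor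
  \<open>m k\<close>; the constants are summable by the case j = 2 of
  \<open>bm_summable\<close>.\<close>

lemma bmW_lipschitz:
  obtains L where "L \<ge> 0" "\<And>t r. t \<in> {-1..0} \<Longrightarrow> r \<in> {-1..0} \<Longrightarrow>
    \<bar>(\<Sum>k. b k * m k * W k t) - (\<Sum>k. b k * m k * W k r)\<bar> \<le> L * \<bar>t - r\<bar>"
proof -
  define L where "L = (\<Sum>k. 2 * (\<bar>b k\<bar> * m k ^ 2))"
  have sm: "summable (\<lambda>k. 2 * (\<bar>b k\<bar> * m k ^ 2))" by (intro summable_mult bm_summable) simp
  have "L \<ge> 0" unfolding L_def by (intro suminf_nonneg sm) simp
  have le: "\<bar>b k * m k * W k u\<bar> \<le> \<bar>b k\<bar> * m k ^ 1" if "u \<in> {-1..0}" for k u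
    using W_bound[OF that, of k] m_nonneg[of k] by (simp add: abs_mult mult_left_le mult_nonneg_nonneg)
  have bmW: "summable (\<lambda>k. b k * m k * W k u)" if "u \<in> {-1..0}" for u
    by (rule summable_comparison_test'[OF bm_summable[of 1], of 0]) (use le[OF that] in auto)
  have "\<bar>(\<Sum>k. b k * m k * W k t) - (\<Sum>k. b k * m k * W k r)\<bar> \<le> L * \<bar>t - r\<bar>"
    if t: "t \<in> {-1..0}" and r: "r \<in> {-1..0}" for t r
  proof -
    have "norm (\<Sum>k. b k * m k * W k t - b k * m k * W k r) \<le> (\<Sum>k. 2 * (\<bar>b k\<bar> * m k ^ 2) * \<bar>t - r\<bar>)"
    proof (rule norm_suminf_le)
      fix k
      have "\<bar>b k\<bar> * m k * \<bar>W k t - W k r\<bar> \<le> \<bar>b k\<bar> * m k * (2 * m k * \<bar>t - r\<bar>)"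
        using W_lipschitz[OF t r, of k] m_nonneg[of k] by (intro mult_left_mono) auto
      moreover have "b k * m k * W k t - b k * m k * W k r = b k * m k * (W k t - W k r)"
        by (simp only: right_diff_distrib)
      ultimately show "norm (b k * m k * W k t - b k * m k * W k r) \<le> 2 * (\<bar>b k\<bar> * m k ^ 2) * \<bar>t - r\<bar>"
        using m_nonneg[of k] by (simp add: abs_mult power2_eq_square mult_ac)
    qed (intro summable_mult2 sm)
    then show ?thesis
      using suminf_diff[OF bmW[OF t] bmW[OF r]] suminf_mult2[OF sm, of "\<bar>t - r\<bar>"] by (simp add: L_def)
  qed
  with \<open>L \<ge> 0\<close> show thesis by (rule that)
qed

text \<open>Between -1/4 and -1/4 + h the term A f changes by A h^\<beta>. If the time derivative
  were \<theta>-Hoelder, this would be at most L h + B h^\<theta>, hence at most (B + L) h^\<theta>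
  for h < 1, which is impossible for small h because \<beta> < \<theta> and A is nonzero.\<close>

lemma v_not_in_holder_t:
  assumes g: "\<And>r. (\<lambda>k. b k * cos (real k * r)) sums bump r"
    and f_eq: "\<And>t. f t = \<bar>t + 1/4\<bar> powr \<beta> - c" and \<theta>: "\<beta> < \<theta>" "\<theta> < 1"
  shows "v \<notin> holder_t (1 + \<theta>) {-(1/2)<..<0} (ball 0 (1/2))"
proof
  let ?I = "{-(1/2)<..<0::real}"
  assume "v \<in> holder_t (1 + \<theta>) ?I (ball 0 (1/2))"
  moreover have fl: "\<lfloor>1 + \<theta>\<rfloor> = 1" using \<theta> \<beta> by (simp add: floor_eq_iff)
  ultimately have "(SUP x\<in>ball 0 (1/2). holder_norm 1 \<theta> ?I (\<lambda>t. v (t, x))) < \<infinity>"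
    by (simp add: holder_t_def)
  moreover have "holder_norm 1 \<theta> ?I (\<lambda>t. v (t, 0)) \<le> (SUP x\<in>ball 0 (1/2). holder_norm 1 \<theta> ?I (\<lambda>t. v (t, x)))"
    by (rule SUP_upper) simp
  ultimately have fin: "holder_norm 1 \<theta> ?I (\<lambda>t. v (t, 0)) < \<infinity>" by (rule le_less_trans[rotated])
  define w where "w = deriv (\<lambda>t. v (t, 0))"
  define S where "S = (SUP (t, t') \<in> {(t, t'). t \<in> ?I \<and> t' \<in> ?I \<and> t \<noteq> t'}. ennreal (\<bar>w t - w t'\<bar> / \<bar>t - t'\<bar> powr \<theta>))"
  have "S < \<infinity>"
    using fin unfolding holder_norm_def by (auto simp: w_def S_def less_top split: if_splits)
  then obtain B where B: "B \<ge> 0" "S = ennreal B" by (cases S) auto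
  have w_holder: "\<bar>w t - w t'\<bar> \<le> B * \<bar>t - t'\<bar> powr \<theta>" if "t \<in> ?I" "t' \<in> ?I" "t \<noteq> t'" for t t'
  proof -
    have "ennreal (\<bar>w t - w t'\<bar> / \<bar>t - t'\<bar> powr \<theta>) \<le> S"
      unfolding S_def by (rule SUP_upper2[of "(t, t')"]) (use that in auto)
    then have "\<bar>w t - w t'\<bar> / \<bar>t - t'\<bar> powr \<theta> \<le> B" using B by simp
    then show ?thesis using that by (simp add: pos_divide_le_eq)
  qed
  have b0: "(\<lambda>k. b k) sums 0" using g[of 0] by (simp add: bump_def)
  obtain L where L: "L \<ge> 0" "\<And>t r. t \<in> {-1..0} \<Longrightarrow> r \<in> {-1..0} \<Longrightarrow>
    \<bar>(\<Sum>k. b k * m k * W k t) - (\<Sum>k. b k * m k * W k r)\<bar> \<le> L * \<bar>t - r\<bar>"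
    using bmW_lipschitz by blast
  show False
  proof (rule powr_le_powr_imp_False[of "\<bar>A\<bar>" "B + L" "\<theta> - \<beta>" "1/4" \<beta>])
    show "\<bar>A\<bar> > 0" using A_nonzero[OF g] by simp
    fix h :: real assume h: "0 < h" "h < 1/4"
    \<comment> \<open>A point to the right of the cusp of \<open>f\<close> at -1/4; for h < 1/4 it
      stays inside the time interval.\<close>
    define t where "t = h - 1/4"
    define r where "r = (- 1/4 :: real)"
    have t: "t \<in> ?I" "r \<in> ?I" "t \<noteq> r" "\<bar>t - r\<bar> = h" using h by (auto simp: t_def r_def)
    have wt: "w u = (\<Sum>k. b k * m k * W k u) - A * f u" if "u \<in> ?I" for u
      unfolding w_def by (rule DERIV_imp_deriv[OF v_at_0_deriv[OF b0]]) (use that in auto)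
    have "f t - f r = h powr \<beta>" using h \<beta> by (simp add: f_eq t_def r_def)
    then have "A * h powr \<beta> = A * f t - A * f r" by (simp flip: right_diff_distrib)
    also have "\<dots> = ((\<Sum>k. b k * m k * W k t) - (\<Sum>k. b k * m k * W k r)) - (w t - w r)"
      using wt[OF t(1)] wt[OF t(2)] by simp
    finally have "\<bar>A * h powr \<beta>\<bar> \<le> L * h + B * h powr \<theta>"
      using L(2)[of t r] w_holder[OF t(1-3)] t by auto
    moreover have "h \<le> h powr \<theta>" using powr_mono'[of \<theta> 1 h] h \<theta> by simp
    then have "L * h \<le> L * h powr \<theta>" using L(1) by (rule mult_left_mono)
    ultimately show "\<bar>A\<bar> * h powr \<beta> \<le> (B + L) * h powr (\<beta> + (\<theta> - \<beta>))"
      by (simp add: abs_mult distrib_right)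
  qed (use B L \<theta> in auto)
qed

end

theorem lemma7p1:
  fixes s \<alpha> :: real
  assumes "s \<in> {0<..<1}" and "\<alpha> \<in> {0<..s}"
  shows "\<exists>\<epsilon>\<^sub>0>0. \<forall>\<epsilon>\<in>{0<..<\<epsilon>\<^sub>0}. \<exists>v :: real \<times> (real ^ 'n) \<Rightarrow> real.
           frac_heat_weak_solution s {-1<..<0} (ball 0 1) v \<and>
           v \<in> holder_tx (\<alpha> / (2 * s) - \<epsilon>) \<alpha> {-1<..<0} UNIV \<and>
           v \<notin> holder_t (1 + \<alpha> / (2 * s)) {-(1/2)<..<0} (ball 0 (1/2))"
\<comment> \<open>This threshold for \<epsilon> is exactly the condition that the Hoelder exponent
  \<alpha>/(2s) - \<epsilon> be positive.\<close>
proof (rule exI[of _ "\<alpha> / (2 * s)"], intro conjI ballI)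
  define \<theta> where "\<theta> = \<alpha> / (2 * s)"
  \<comment> \<open>The assumption \<alpha> <= s even gives \<theta> <= 1/2.\<close>
  have \<theta>: "0 < \<theta>" "\<theta> < 1" using assms by (auto simp: \<theta>_def)
  then show "\<alpha> / (2 * s) > 0" by (simp add: \<theta>_def)
  fix \<epsilon> assume \<epsilon>: "\<epsilon> \<in> {0<..<\<alpha> / (2 * s)}"
  define \<beta> where "\<beta> = \<theta> - \<epsilon>"
  have \<beta>: "0 < \<beta>" and \<beta>_less: "\<beta> < \<theta>" using \<epsilon> by (auto simp: \<beta>_def \<theta>_def)
  \<comment> \<open>The cusp sits at the midpoint of (-1/2, 0); the subtracted constant makes f(-1)
    = 0.\<close>
  define f where "f t = \<bar>t + 1/4\<bar> powr \<beta> - (3/4) powr \<beta>" for t :: real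
  obtain b where b_decay: "summable (\<lambda>k. \<bar>b k\<bar> * real (Suc k) ^ 4)"
    and b_sums: "\<And>r. (\<lambda>k. b k * cos (real k * r)) sums bump r"
    using bump_cosine_series by blast
  obtain e :: "real ^ 'n" where e: "norm e = 1" using norm_Basis nonempty_Basis by blast
  have f_holder: "\<bar>f t - f r\<bar> \<le> \<bar>t - r\<bar> powr \<beta>" for t r
  proof -
    have "\<bar>f t - f r\<bar> \<le> \<bar>\<bar>t + 1/4\<bar> - \<bar>r + 1/4\<bar>\<bar> powr \<beta>"
      using powr_diff_le[of "\<bar>t + 1/4\<bar>" "\<bar>r + 1/4\<bar>" \<beta>] \<beta> \<beta>_less \<theta> by (simp add: f_def)
    also have "\<dots> \<le> \<bar>t - r\<bar> powr \<beta>" using \<beta> by (intro powr_mono2) auto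
    finally show ?thesis .
  qed
  have f_cont: "continuous_on {-1..0} f"
    unfolding f_def using \<beta> by (intro continuous_intros continuous_on_powr') auto
  have "\<exists>y. y (-1) = 0 \<and> (\<forall>t\<in>{-1..0}. (y has_real_derivative frac_symbol s (real k *\<^sub>R e) * (f t - y t)) (at t within {-1..0}))" for k
    using relaxation_solution_exists[OF f_cont] by metis
  then obtain W where W: "\<And>k. W k (-1) = 0"
    "\<And>k t. t \<in> {-1..0} \<Longrightarrow> (W k has_real_derivative frac_symbol s (real k *\<^sub>R e) * (f t - W k t)) (at t within {-1..0})"
    by metis
  interpret heat_series s \<beta> e b f W
    by unfold_locales (use assms \<beta> e b_decay f_holder W in \<open>auto simp: f_def\<close>)
  have g0: "(\<lambda>k. b k * cos (real k * (e \<bullet> x))) sums 0" if "norm x < 1" for x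
  proof -
    \<comment> \<open>Since 1 < pi/2, the cosine is positive on the unit ball and
      \<open>bump\<close> vanishes there.\<close>
    have "\<bar>e \<bullet> x\<bar> < 1" using Cauchy_Schwarz_ineq2[of e x] e that by simp
    then have "cos (e \<bullet> x) > 0" using pi_gt3 by (intro cos_gt_zero_pi) auto
    then have "bump (e \<bullet> x) = 0" by (simp add: bump_def)
    then show ?thesis using b_sums[of "e \<bullet> x"] by simp
  qed
  have "v \<in> holder_tx (\<alpha> / (2 * s) - \<epsilon>) \<alpha> {-1<..<0} UNIV"
    using v_in_holder_tx[of \<alpha>] assms by (simp add: \<beta>_def \<theta>_def)
  moreover have "v \<notin> holder_t (1 + \<alpha> / (2 * s)) {-(1/2)<..<0} (ball 0 (1/2))"
    using v_not_in_holder_t[OF b_sums f_def \<beta>_less \<theta>(2)] by (simp add: \<theta>_def)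
  ultimately show "\<exists>v :: real \<times> (real ^ 'n) \<Rightarrow> real.
      frac_heat_weak_solution s {-1<..<0} (ball 0 1) v \<and>
      v \<in> holder_tx (\<alpha> / (2 * s) - \<epsilon>) \<alpha> {-1<..<0} UNIV \<and>
      v \<notin> holder_t (1 + \<alpha> / (2 * s)) {-(1/2)<..<0} (ball 0 (1/2))"
    using v_weak_solution[OF g0] by blast
qed

end
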